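(* Let $\mathcal{R}$ be a discrete, measure-preserving equivalence relation over a standard probability space $(X,\mu)$, and fix $\pi\in L^1(X,\mu)$ with $\pi(x)\in(0,\infty)$ for almost every $x\in X$. Let $f_k:\mathcal{R}\to[0,\infty]$, $k\geq1$, be a sequence of measurable functions such that: (a) for all $k\in\mathbb{N}$, $\pi(x)f_k(x,y)=\pi(y)f_k(y,x)$ for almost every $(x,y)\in\mathcal{R}$; (b) for all $l,k\in\mathbb{N}$, $\sum_{y,z\in[x]_{\mathcal{R}}}f_l(x,z)f_k(z,y)\leq\sum_{y\in[x]_{\mathcal{R}}}f_{l+k}(x,y)$ for almost every $x\in X$; (c) for almost every $x\in X$ and every $k\in\mathbb{N}$, $0<\sum_{y\in[x]_{\mathcal{R}}}f_k(x,y)<\infty$; (d) there is a measurable $D:X\to(0,\infty)$ such that $\sum_{y\in[x]_{\mathcal{R}}}f_{l+k}(x,y)\geq D(x)^l\sum_{y\in[x]_{\mathcal{R}}}f_k(x,y)$ for almost every $x\in X$ and every $l,k\in\mathbb{N}$. Then $$\widetilde f(x)=\lim_{k\to\infty}\Big(\sum_{y\in[x]_{\mathcal{R}}}f_k(x,y)\Big)^{1/k}$$ exists and is positive for almost every $x\in X$. Further: (i) for every $k\in\mathbb{N}$, $$\int\pi(x)\frac{\sum_{y\in[x]_{\mathcal{R}}}f_k(x,y)}{\widetilde f(x)^k}\,d\mu(x)\leq\int\pi\,d\mu;$$ (ii) $\displaystyle\lim_{k\to\infty}\Big(\int\pi(x)\sum_{y\in[x]_{\mathcal{R}}}f_k(x,y)\,d\mu(x)\Big)^{1/k}=\|\widetilde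 f\|_\infty.$
   Context: $\mathbb{N}=\{1,2,\dots\}$. An equivalence relation $\mathcal{R}$ over $(X,\mu)$ is a Borel subset of $X\times X$ that is an equivalence relation on $X$; $[x]_{\mathcal{R}}$ is the class of $x$. It is discrete if almost every class is countable; then $\mathcal{R}$ carries the measure $\overline\mu(E)=\int_X|\{y:(x,y)\in E\}|\,d\mu(x)$, and "almost every $(x,y)\in\mathcal{R}$" refers to $\overline\mu$. It is measure-preserving if $(x,y)\mapsto(y,x)$ preserves $\overline\mu$, equivalently $\int_X\sum_{y\in[x]_{\mathcal{R}}}f(x,y)\,d\mu(x)=\int_X\sum_{y\in[x]_{\mathcal{R}}}f(y,x)\,d\mu(x)$ for every Borel $f:\mathcal{R}\to[0,\infty]$. Limits, integrals and $\|\cdot\|_\infty$ (essential supremum) are taken in $[0,\infty]$, with $1/\infty=0$. *)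

theory Defs
  imports "HOL-Probability.Probability"
begin

definition standard_borel :: "'a measure \<Rightarrow> bool" where
  "standard_borel M \<longleftrightarrow>
     (\<exists>T. completely_metrizable_space T \<and> separable_space T \<and>
          topspace T = space M \<and> sets M = sigma_sets (space M) {U. openin T U})"

definition standard_prob_space :: "'a measure \<Rightarrow> bool" where
  "standard_prob_space M \<longleftrightarrow> prob_space M \<and> standard_borel M"

text \<open>The class of \<open>x\<close> under \<open>R\<close> is \<open>R `` {x}\<close>.\<close>

definition discrete_equiv_rel :: "'a measure \<Rightarrow> ('a \<times> 'a) set \<Rightarrow> bool" where
  "discrete_equiv_rel M R \<longleftrightarrow>
     R \<in> sets (M \<Otimes>\<^sub>M M) \<and> equiv (space M) R \<and> (AE x in M. countable (R `` {x}))"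

text \<open>
  The set function below is countably additive whenever \<open>discrete_equiv_rel M R\<close> holds over a
  standard probability space (Lusin--Novikov: the integrand agrees almost everywhere with a
  Borel function); \<^const>\<open>measure_of\<close> would otherwise yield the zero measure.
\<close>

definition rel_measure :: "'a measure \<Rightarrow> ('a \<times> 'a) set \<Rightarrow> ('a \<times> 'a) measure" where
  "rel_measure M R =
     measure_of R (sets (restrict_space (M \<Otimes>\<^sub>M M) R))
       (\<lambda>E. \<integral>\<^sup>+x. emeasure (count_space UNIV) {y. (x, y) \<in> E} \<partial>M)"

definition measure_preserving_rel :: "'a measure \<Rightarrow> ('a \<times> 'a) set \<Rightarrow> bool" where
  "measure_preserving_rel M R \<longleftrightarrow>
     distr (rel_measure M R) (rel_measure M R) (\<lambda>(x, y). (y, x)) = rel_measure M R"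

definition class_sum :: "('a \<times> 'a) set \<Rightarrow> ('a \<times> 'a \<Rightarrow> ennreal) \<Rightarrow> 'a \<Rightarrow> ennreal" where
  "class_sum R g x = (\<Sum>\<^sub>\<infinity>y\<in>R `` {x}. g (x, y))"

definition ennroot :: "nat \<Rightarrow> ennreal \<Rightarrow> ennreal" where
  "ennroot n a = (if a = \<infinity> then \<infinity> else ennreal (root n (enn2real a)))"

lemma ennroot_power:
  assumes "0 < n"
  shows "ennroot n a ^ n = a"
proof (cases a)
  case (real r)
  then show ?thesis
    using assms by (simp add: ennroot_def ennreal_power)
next
  case top
  then show ?thesis
    using assms by (simp add: ennroot_def top_power_ennreal)
qed

definition growth_rate ::
  "('a \<times> 'a) set \<Rightarrow> (nat \<Rightarrow> 'a \<times> 'a \<Rightarrow> ennreal) \<Rightarrow> 'a \<Rightarrow> ennreal" where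
  "growth_rate R f x = lim (\<lambda>k. ennroot k (class_sum R (f k) x))"

text \<open>
  For a function that is not measurable, \<^const>\<open>esssup\<close> returns \<open>\<top>\<close> by convention.
  \<^const>\<open>growth_rate\<close> may fail to be Borel on a null set (for instance on uncountable classes),
  so its essential supremum is taken over the completion, with respect to which it is measurable.
\<close>

definition Linf_norm :: "'a measure \<Rightarrow> ('a \<Rightarrow> ennreal) \<Rightarrow> ennreal" where
  "Linf_norm M g = esssup (completion M) g"

end

theory Submission
  imports Defs
begin

text \<open>
  Write \<open>F k x\<close> for the sum of \<open>f k\<close> over the class of \<open>x\<close>, with \<open>F 0 = 1\<close>. Everything rests on one
  inequality: for \<open>k \<ge> 0\<close> and \<open>l \<ge> 1\<close>, the integral of \<open>\<pi> * F k * (F l)\<^sup>2 / F (k + 2 * l)\<close> is at most the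
  integral of \<open>\<pi>\<close> (\<open>nn_integral_weight_ratio\<close>). It follows from the Cauchy--Schwarz inequality on each
  class, the mass transport principle, and reversibility and supermultiplicativity of the kernels.

  Existence of the limit. Since there are countably many pairs \<open>(k, l)\<close>, the inequality bounds
  \<open>F k * (F l)\<^sup>2 / F (k + 2 * l)\<close> almost everywhere by a polynomial in \<open>k + l\<close>. So \<open>ln (F k)\<close> is almost
  superadditive, and a Fekete type lemma (\<open>almost_superadditive_limit\<close>) shows that \<open>ln (F k) / k\<close>
  converges to a limit in \<open>(-\<infinity>, \<infinity>]\<close>. The lower bound through \<open>D\<close> serves there to interpolate between
  the multiples of a fixed index.

  The integral bound. For \<open>k = 0\<close> the inequality controls \<open>(F l)\<^sup>2 / F (2 * l)\<close>. Iterating along \<open>l\<close>,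
  \<open>2 * l\<close>, \<open>4 * l\<close> and so on, with the inequality of arithmetic and geometric means, the integral of
  \<open>\<pi> * F l / F (2 ^ N * l) powr (1 / 2 ^ N)\<close> is at most the integral of \<open>\<pi>\<close>; Fatou's lemma gives the
  bound in the limit (\<open>nn_integral_weight_div_rate\<close>).

  The essential supremum. The integral bound yields the upper estimate, as \<open>F k\<close> is at most
  \<open>S ^ k * F k / rate ^ k\<close> for the essential supremum \<open>S\<close> of the growth rate. For the lower estimate, on
  the set where the growth rate exceeds \<open>c < S\<close> eventually \<open>F k \<ge> c ^ k\<close>, and Fatou's lemma applies
  once more.

  Mass transport and the passage between null sets of \<open>M\<close> and of the measure on the relation require
  that this measure is countably additive. That holds because, for every Borel set \<open>E\<close>, the number of
  points of \<open>{y. (x, y) \<in> E}\<close> is a function of \<open>x\<close> that is measurable with respect to the completion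
  of \<open>M\<close> (\<open>measurable_section_count\<close>). This is deduced from the universal measurability of projections
  of Borel sets (\<open>measurable_projection\<close>), which in turn is proved through the Souslin operation.
\<close>

section \<open>The Souslin operation and universal measurability\<close>

text \<open>
  A scheme \<open>B\<close> assigns to every index \<open>n\<close> and every branch \<open>\<sigma>\<close> of the tree of finite sequences of
  naturals a value that is determined by a finite initial segment of \<open>\<sigma>\<close>, whose length may depend on
  \<open>n\<close> only. Working with whole branches instead of finite sequences keeps the reindexing of schemes
  free of list bookkeeping.
\<close>

definition finitely_dependent :: "(nat \<Rightarrow> (nat \<Rightarrow> nat) \<Rightarrow> 'b) \<Rightarrow> bool" where
  "finitely_dependent B \<longleftrightarrow> (\<forall>n. \<exists>h. \<forall>\<sigma> \<tau>. (\<forall>i<h. \<sigma> i = \<tau> i) \<longrightarrow> B n \<sigma> = B n \<tau>)"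

text \<open>The sets obtained from a family \<open>\<G>\<close> by the Souslin operation.\<close>

definition souslin :: "'b set set \<Rightarrow> 'b set set" where
  "souslin \<G> = {S. \<exists>B. (\<forall>n \<sigma>. B n \<sigma> \<in> \<G>) \<and> finitely_dependent B \<and> S = {p. \<exists>\<sigma>. \<forall>n. p \<in> B n \<sigma>}}"

lemma souslinI:
  assumes "\<And>n \<sigma>. B n \<sigma> \<in> \<G>" "finitely_dependent B" "\<And>p. p \<in> S \<longleftrightarrow> (\<exists>\<sigma>. \<forall>n. p \<in> B n \<sigma>)"
  shows "S \<in> souslin \<G>"
  unfolding souslin_def using assms by (intro CollectI exI[of _ B]) auto

lemma souslinE:
  assumes "S \<in> souslin \<G>"
  obtains B where "\<And>n \<sigma>. B n \<sigma> \<in> \<G>" "finitely_dependent B" "\<And>p. p \<in> S \<longleftrightarrow> (\<exists>\<sigma>. \<forall>n. p \<in> B n \<sigma>)"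
  using assms unfolding souslin_def by auto

lemma finitely_dependentD:
  assumes "finitely_dependent B"
  obtains h where "\<And>n \<sigma> \<tau>. (\<And>i. i < h n \<Longrightarrow> \<sigma> i = \<tau> i) \<Longrightarrow> B n \<sigma> = B n \<tau>"
  using assms unfolding finitely_dependent_def by metis

lemma souslin_basic: "G \<in> \<G> \<Longrightarrow> G \<in> souslin \<G>"
  by (rule souslinI[of "\<lambda>_ _. G"]) (auto simp: finitely_dependent_def)

text \<open>
  If \<open>\<G>\<close> has a largest member, the \<open>n\<close>-th set of the scheme can be made to depend on the first
  \<open>n\<close> entries of the branch only: each condition is postponed until enough entries are known, and the
  largest member fills the gaps.
\<close>

lemma souslin_normalE:
  fixes S :: "'b set"
  assumes "S \<in> souslin \<G>" and top: "\<Omega> \<in> \<G>" "\<And>G. G \<in> \<G> \<Longrightarrow> G \<subseteq> \<Omega>"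
  obtains B :: "nat \<Rightarrow> (nat \<Rightarrow> nat) \<Rightarrow> 'b set"
  where "\<And>n \<sigma>. B n \<sigma> \<in> \<G>" "\<And>n \<sigma> \<tau>. (\<And>i. i < n \<Longrightarrow> \<sigma> i = \<tau> i) \<Longrightarrow> B n \<sigma> = B n \<tau>"
    "\<And>p. p \<in> S \<longleftrightarrow> (\<exists>\<sigma>. \<forall>n. p \<in> B n \<sigma>)"
proof -
  obtain B where B: "\<And>n \<sigma>. B n \<sigma> \<in> \<G>" "finitely_dependent B" "\<And>p. p \<in> S \<longleftrightarrow> (\<exists>\<sigma>. \<forall>n. p \<in> B n \<sigma>)"
    using assms(1) by (elim souslinE) blast
  obtain h where h: "\<And>n \<sigma> \<tau>. (\<And>i. i < h n \<Longrightarrow> \<sigma> i = \<tau> i) \<Longrightarrow> B n \<sigma> = B n \<tau>"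
    using finitely_dependentD[OF B(2)] by blast
  define C where "C m \<sigma> = (if h (fst (prod_decode m)) \<le> m then B (fst (prod_decode m)) \<sigma> else \<Omega>)"
    for m \<sigma>
  have iff: "(\<forall>m. p \<in> C m \<sigma>) \<longleftrightarrow> (\<forall>n. p \<in> B n \<sigma>)" for p \<sigma>
  proof
    assume C: "\<forall>m. p \<in> C m \<sigma>"
    show "\<forall>n. p \<in> B n \<sigma>"
    proof
      fix n
      define m where "m = prod_encode (n, h n)"
      have "h n \<le> m"
        unfolding m_def by (rule le_prod_encode_2)
      then show "p \<in> B n \<sigma>"
        using C[rule_format, of m] by (simp add: C_def m_def)
    qed
  next
    assume "\<forall>n. p \<in> B n \<sigma>"
    then show "\<forall>m. p \<in> C m \<sigma>"
      using top(2)[OF B(1)] by (auto simp: C_def)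
  qed
  show ?thesis
  proof (rule that[of C])
    show "C n \<sigma> \<in> \<G>" for n \<sigma>
      using B(1) top(1) by (simp add: C_def)
    show "C n \<sigma> = C n \<tau>" if "\<And>i. i < n \<Longrightarrow> \<sigma> i = \<tau> i" for n \<sigma> \<tau>
      using that by (auto simp: C_def intro!: h)
    show "p \<in> S \<longleftrightarrow> (\<exists>\<sigma>. \<forall>n. p \<in> C n \<sigma>)" for p
      using iff B(3) by simp
  qed
qed

lemma souslin_UN:
  assumes S: "\<And>i::nat. S i \<in> souslin \<G>" and top: "\<Omega> \<in> \<G>" "\<And>G. G \<in> \<G> \<Longrightarrow> G \<subseteq> \<Omega>"
  shows "(\<Union>i. S i) \<in> souslin \<G>"
proof -
  have "\<exists>B :: nat \<Rightarrow> (nat \<Rightarrow> nat) \<Rightarrow> _. (\<forall>n \<sigma>. B n \<sigma> \<in> \<G>) \<and> (\<forall>n \<sigma> \<tau>. (\<forall>i<n. \<sigma> i = \<tau> i) \<longrightarrow> B n \<sigma> = B n \<tau>) \<and>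
      (\<forall>p. p \<in> S i \<longleftrightarrow> (\<exists>\<sigma>. \<forall>n. p \<in> B n \<sigma>))" for i
    by (rule souslin_normalE[OF S[of i] top]) (assumption, blast)
  then obtain B :: "nat \<Rightarrow> nat \<Rightarrow> (nat \<Rightarrow> nat) \<Rightarrow> _" where B: "\<And>i n \<sigma>. B i n \<sigma> \<in> \<G>"
      "\<And>i n \<sigma> \<tau>. (\<forall>j<n. \<sigma> j = \<tau> j) \<Longrightarrow> B i n \<sigma> = B i n \<tau>"
      "\<And>i p. p \<in> S i \<longleftrightarrow> (\<exists>\<sigma>. \<forall>n. p \<in> B i n \<sigma>)"
    by metis
  show ?thesis
  proof (rule souslinI[of "\<lambda>n \<sigma>. B (\<sigma> 0) n (\<lambda>j. \<sigma> (Suc j))"])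
    show "finitely_dependent (\<lambda>n \<sigma>. B (\<sigma> 0) n (\<lambda>j. \<sigma> (Suc j)))"
      unfolding finitely_dependent_def
    proof (intro allI exI impI)
      fix n and \<sigma> \<tau> :: "nat \<Rightarrow> nat"
      assume "\<forall>i<Suc n. \<sigma> i = \<tau> i"
      then show "B (\<sigma> 0) n (\<lambda>j. \<sigma> (Suc j)) = B (\<tau> 0) n (\<lambda>j. \<tau> (Suc j))"
        using B(2)[of n "\<lambda>j. \<sigma> (Suc j)" "\<lambda>j. \<tau> (Suc j)" "\<tau> 0"] by simp
    qed
    fix p
    show "p \<in> (\<Union>i. S i) \<longleftrightarrow> (\<exists>\<sigma>. \<forall>n. p \<in> B (\<sigma> 0) n (\<lambda>j. \<sigma> (Suc j)))"
    proof
      assume "p \<in> (\<Union>i. S i)"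
      then obtain i \<sigma> where "\<forall>n. p \<in> B i n \<sigma>"
        using B(3) by auto
      then show "\<exists>\<sigma>. \<forall>n. p \<in> B (\<sigma> 0) n (\<lambda>j. \<sigma> (Suc j))"
        by (intro exI[of _ "case_nat i \<sigma>"]) simp
    qed (use B(3) in blast)
  qed (use B in auto)
qed

lemma souslin_INT:
  assumes S: "\<And>i::nat. S i \<in> souslin \<G>"
  shows "(\<Inter>i. S i) \<in> souslin \<G>"
proof -
  have "\<exists>B. (\<forall>n \<sigma>. B n \<sigma> \<in> \<G>) \<and> finitely_dependent B \<and> (\<forall>p. p \<in> S i \<longleftrightarrow> (\<exists>\<sigma>. \<forall>n. p \<in> B n \<sigma>))" for i
    using S[of i] by (elim souslinE) blast
  then obtain B where B: "\<And>i n \<sigma>. B i n \<sigma> \<in> \<G>" "\<And>i. finitely_dependent (B i)"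
      "\<And>i p. p \<in> S i \<longleftrightarrow> (\<exists>\<sigma>. \<forall>n. p \<in> B i n \<sigma>)"
    by metis
  define C where "C m \<sigma> = (case prod_decode m of (i, n) \<Rightarrow> B i n (\<lambda>j. \<sigma> (prod_encode (i, j))))"
    for m and \<sigma> :: "nat \<Rightarrow> nat"
  have C: "C (prod_encode (i, n)) \<sigma> = B i n (\<lambda>j. \<sigma> (prod_encode (i, j)))" for i n \<sigma>
    by (simp add: C_def)
  show ?thesis
  proof (rule souslinI[of C])
    show "C n \<sigma> \<in> \<G>" for n \<sigma>
      using B(1) by (auto simp: C_def split: prod.splits)
    show "finitely_dependent C"
      unfolding finitely_dependent_def
    proof
      fix m
      obtain i n where m: "m = prod_encode (i, n)"
        by (metis prod_decode_inverse surj_pair)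
      obtain h where h: "\<And>n \<sigma> \<tau>. (\<And>j. j < h n \<Longrightarrow> \<sigma> j = \<tau> j) \<Longrightarrow> B i n \<sigma> = B i n \<tau>"
        using finitely_dependentD[OF B(2)] by blast
      show "\<exists>H. \<forall>\<sigma> \<tau>. (\<forall>j<H. \<sigma> j = \<tau> j) \<longrightarrow> C m \<sigma> = C m \<tau>"
      proof (intro exI allI impI)
        fix \<sigma> \<tau> :: "nat \<Rightarrow> nat"
        assume eq: "\<forall>j<Suc (Max ((\<lambda>j. prod_encode (i, j)) ` {..h n})). \<sigma> j = \<tau> j"
        have "prod_encode (i, j) < Suc (Max ((\<lambda>j. prod_encode (i, j)) ` {..h n}))" if "j < h n" for j
          using that by (auto simp: less_Suc_eq_le intro!: Max_ge)
        then show "C m \<sigma> = C m \<tau>"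
          unfolding m C using eq by (intro h) blast
      qed
    qed
    fix p
    show "p \<in> (\<Inter>i. S i) \<longleftrightarrow> (\<exists>\<sigma>. \<forall>n. p \<in> C n \<sigma>)"
    proof
      assume "p \<in> (\<Inter>i. S i)"
      then have "\<forall>i. \<exists>\<sigma>. \<forall>n. p \<in> B i n \<sigma>"
        using B(3) by auto
      then obtain s where s: "\<And>i n. p \<in> B i n (s i)"
        by metis
      have "p \<in> C m (\<lambda>q. case prod_decode q of (i, j) \<Rightarrow> s i j)" for m
        using s by (auto simp: C_def split: prod.splits)
      then show "\<exists>\<sigma>. \<forall>n. p \<in> C n \<sigma>"
        by blast
    next
      assume "\<exists>\<sigma>. \<forall>n. p \<in> C n \<sigma>"
      then obtain \<sigma> where \<sigma>: "\<And>n. p \<in> C n \<sigma>"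
        by blast
      show "p \<in> (\<Inter>i. S i)"
      proof
        fix i
        show "p \<in> S i"
          unfolding B(3) using \<sigma>[of "prod_encode (i, _)"] by (auto simp: C)
      qed
    qed
  qed
qed

text \<open>Dependent choice for properties of finite prefixes.\<close>

lemma exists_sequence_of_prefixes:
  assumes "P []" and step: "\<And>xs. P xs \<Longrightarrow> \<exists>j. P (xs @ [j])"
  obtains k :: "nat \<Rightarrow> 'b" where "\<And>n. P (map k [0..<n])"
proof -
  have "\<exists>X. \<forall>n. (P (X n) \<and> (n = 0 \<longrightarrow> X n = [])) \<and> (\<exists>j. X (Suc n) = X n @ [j])"
  proof (rule dependent_nat_choice)
    show "\<exists>xs. P xs \<and> (0 = 0 \<longrightarrow> xs = [])"
      using assms(1) by blast
    show "\<exists>ys. (P ys \<and> (Suc n = 0 \<longrightarrow> ys = [])) \<and> (\<exists>j. ys = xs @ [j])"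
      if "P xs \<and> (n = 0 \<longrightarrow> xs = [])" for xs n
      using step[of xs] that by blast
  qed
  then obtain X where X: "\<And>n. P (X n)" "X 0 = []" "\<And>n. \<exists>j. X (Suc n) = X n @ [j]"
    by (metis (no_types))
  have "X n = map (\<lambda>i. last (X (Suc i))) [0..<n]" for n
  proof (induction n)
    case (Suc n)
    obtain j where "X (Suc n) = X n @ [j]"
      using X(3) by blast
    then show ?case
      using Suc.IH by simp
  qed (use X(2) in simp)
  then show ?thesis
    using X(1) that by metis
qed

text \<open>Sequential compactness of a product of finite sets, in the form of Koenig's lemma.\<close>

lemma exists_cluster_sequence:
  fixes s :: "nat \<Rightarrow> nat \<Rightarrow> nat"
  assumes bd: "\<And>n i. s n i \<le> k i"
  obtains \<sigma> where "\<And>h. \<exists>\<^sub>\<infinity>n. \<forall>i<h. s n i = \<sigma> i"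
proof -
  define Q where "Q xs \<longleftrightarrow> (\<exists>\<^sub>\<infinity>n. \<forall>i<length xs. s n i = xs ! i)" for xs
  have "Q []"
    by (simp add: Q_def)
  moreover have "\<exists>j. Q (xs @ [j])" if xs: "Q xs" for xs
  proof -
    let ?h = "length xs"
    let ?N = "{n. \<forall>i<?h. s n i = xs ! i}"
    have "infinite ?N"
      using xs by (simp add: Q_def INFM_iff_infinite)
    moreover have "finite ((\<lambda>n. s n ?h) ` ?N)"
      by (rule finite_subset[of _ "{..k ?h}"]) (auto intro: bd)
    ultimately obtain m where "infinite {n \<in> ?N. s n ?h = s m ?h}"
      using pigeonhole_infinite[of ?N "\<lambda>n. s n ?h"] by auto
    moreover have "{n \<in> ?N. s n ?h = s m ?h} \<subseteq> {n. \<forall>i<Suc ?h. s n i = (xs @ [s m ?h]) ! i}"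
      by (auto simp: nth_append less_Suc_eq)
    ultimately have "Q (xs @ [s m ?h])"
      by (auto simp: Q_def INFM_iff_infinite dest: infinite_super)
    then show ?thesis ..
  qed
  ultimately obtain \<sigma> where \<sigma>: "\<And>n. Q (map \<sigma> [0..<n])"
    using exists_sequence_of_prefixes[of Q] by blast
  show ?thesis
  proof (rule that[of \<sigma>])
    fix h
    have "(\<forall>i<h. s n i = map \<sigma> [0..<h] ! i) \<longleftrightarrow> (\<forall>i<h. s n i = \<sigma> i)" for n
      by auto
    then show "\<exists>\<^sub>\<infinity>n. \<forall>i<h. s n i = \<sigma> i"
      using \<sigma>[of h] by (simp add: Q_def)
  qed
qed

text \<open>
  Universal measurability of analytic sets. If \<open>c\<close> lies below the outer measure of \<open>S\<close>, continuity of
  the outer measure along increasing sequences allows one to bound the entries of the branches, one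
  after the other, by numbers \<open>k i\<close> without the outer measure dropping to \<open>c\<close>. The branches bounded by
  \<open>k\<close> form a compact set, so the finite stages \<open>T n\<close> of the scheme over these branches are measurable
  and decrease to a subset of \<open>S\<close> of measure at least \<open>c\<close>.
\<close>

lemma souslin_completion:
  fixes M :: "'b measure"
  assumes "finite_measure M" and S: "S \<in> souslin (sets M)"
  shows "S \<in> sets (completion M)"
proof -
  interpret finite_measure M by fact
  obtain B :: "nat \<Rightarrow> (nat \<Rightarrow> nat) \<Rightarrow> 'b set" where B: "\<And>n \<sigma>. B n \<sigma> \<in> sets M"
      "\<And>n \<sigma> \<tau>. (\<And>i. i < n \<Longrightarrow> \<sigma> i = \<tau> i) \<Longrightarrow> B n \<sigma> = B n \<tau>"
      "\<And>p. p \<in> S \<longleftrightarrow> (\<exists>\<sigma>. \<forall>n. p \<in> B n \<sigma>)"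
    using souslin_normalE[OF S sets.top sets.sets_into_space] by metis
  have S_space: "S \<subseteq> space M"
    using B(3) sets.sets_into_space[OF B(1)] by blast
  have approx: "\<exists>L\<in>sets M. L \<subseteq> S \<and> c \<le> emeasure M L" if c: "c < outer_measure_of M S" for c
  proof -
    define P where "P xs = {p. \<exists>\<sigma>. (\<forall>i<length xs. \<sigma> i \<le> xs ! i) \<and> (\<forall>n. p \<in> B n \<sigma>)}" for xs
    have "P [] = S"
      using B(3) by (auto simp: P_def)
    then have "c < outer_measure_of M (P [])"
      using c by simp
    moreover have "\<exists>j. c < outer_measure_of M (P (xs @ [j]))" if xs: "c < outer_measure_of M (P xs)" for xs
    proof -
      have "(\<Union>j. P (xs @ [j])) = P xs"
      proof (intro equalityI subsetI)
        fix p
        assume "p \<in> P xs"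
        then obtain \<sigma> where \<sigma>: "\<And>i. i < length xs \<Longrightarrow> \<sigma> i \<le> xs ! i" "\<And>n. p \<in> B n \<sigma>"
          by (auto simp: P_def)
        then have "p \<in> P (xs @ [\<sigma> (length xs)])"
          by (auto simp: P_def nth_append less_Suc_eq intro!: exI[of _ \<sigma>])
        then show "p \<in> (\<Union>j. P (xs @ [j]))"
          by blast
      next
        fix p
        assume "p \<in> (\<Union>j. P (xs @ [j]))"
        then obtain j \<sigma> where \<sigma>: "\<And>i. i < Suc (length xs) \<Longrightarrow> \<sigma> i \<le> (xs @ [j]) ! i" "\<And>n. p \<in> B n \<sigma>"
          by (auto simp: P_def)
        have "\<sigma> i \<le> xs ! i" if "i < length xs" for i
          using \<sigma>(1)[of i] that by (simp add: nth_append)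
        then show "p \<in> P xs"
          using \<sigma>(2) by (auto simp: P_def)
      qed
      moreover have "incseq (\<lambda>j. P (xs @ [j]))"
      proof (rule incseq_SucI, rule subsetI)
        fix j p
        assume "p \<in> P (xs @ [j])"
        then obtain \<sigma> where \<sigma>: "\<And>i. i < Suc (length xs) \<Longrightarrow> \<sigma> i \<le> (xs @ [j]) ! i" "\<And>n. p \<in> B n \<sigma>"
          by (auto simp: P_def)
        have "\<sigma> i \<le> (xs @ [Suc j]) ! i" if "i < Suc (length xs)" for i
          using \<sigma>(1)[OF that] that by (auto simp: nth_append split: if_splits)
        then show "p \<in> P (xs @ [Suc j])"
          using \<sigma>(2) by (auto simp: P_def)
      qed
      moreover have "P ys \<subseteq> space M" for ys
        using S_space B(3) by (auto simp: P_def)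
      ultimately have "(SUP j. outer_measure_of M (P (xs @ [j]))) = outer_measure_of M (P xs)"
        using SUP_outer_measure_of_incseq[of "\<lambda>j. P (xs @ [j])" M] by simp
      then show ?thesis
        using xs by (metis (no_types, lifting) less_SUP_iff)
    qed
    ultimately obtain k where k: "\<And>n. c < outer_measure_of M (P (map k [0..<n]))"
      using exists_sequence_of_prefixes[of "\<lambda>xs. c < outer_measure_of M (P xs)"] by blast
    define K where "K = {\<sigma>. \<forall>i. \<sigma> i \<le> k i}"
    define T where "T n = (\<Union>\<sigma>\<in>K. \<Inter>m\<in>{..n}. B m \<sigma>)" for n
    \<comment> \<open>only the first \<open>n\<close> entries matter, so the union over \<open>K\<close> is a finite one\<close>
    have T_sets: "T n \<in> sets M" for n
    proof -
      have "(\<lambda>\<sigma>. \<Inter>m\<in>{..n}. B m \<sigma>) ` K = (\<lambda>\<sigma>. \<Inter>m\<in>{..n}. B m \<sigma>) ` (\<lambda>\<sigma>. restrict \<sigma> {..<n}) ` K"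
        unfolding image_image by (intro image_cong INF_cong refl B(2)) auto
      moreover have "finite ((\<lambda>\<sigma>. restrict \<sigma> {..<n}) ` K)"
        by (rule finite_subset[of _ "PiE {..<n} (\<lambda>i. {..k i})"])
          (simp_all add: image_subset_iff restrict_PiE_iff K_def finite_PiE)
      ultimately have "finite ((\<lambda>\<sigma>. \<Inter>m\<in>{..n}. B m \<sigma>) ` K)"
        by simp
      then show ?thesis
        unfolding T_def using B(1) by (intro sets.finite_Union) auto
    qed
    have T_dec: "decseq T"
      by (fastforce simp: decseq_def T_def)
    have T_sub: "(\<Inter>n. T n) \<subseteq> S"
    proof
      fix p
      assume "p \<in> (\<Inter>n. T n)"
      then have "\<exists>\<sigma>\<in>K. \<forall>m\<in>{..n}. p \<in> B m \<sigma>" for n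
        unfolding T_def by blast
      then have "\<forall>n. \<exists>\<sigma>. \<sigma> \<in> K \<and> (\<forall>m\<le>n. p \<in> B m \<sigma>)"
        by (metis atMost_iff)
      then obtain s where s: "\<And>n. s n \<in> K" "\<And>n m. m \<le> n \<Longrightarrow> p \<in> B m (s n)"
        by metis
      obtain \<sigma> where \<sigma>: "\<And>h. \<exists>\<^sub>\<infinity>n. \<forall>i<h. s n i = \<sigma> i"
        using exists_cluster_sequence[of s k] s(1) by (auto simp: K_def)
      have "p \<in> B m \<sigma>" for m
      proof -
        obtain n where "m \<le> n" "\<forall>i<m. s n i = \<sigma> i"
          using \<sigma>[of m] by (auto simp: INFM_nat_le)
        then show ?thesis
          using s(2)[of m n] B(2)[of m "s n" \<sigma>] by simp
      qed
      then show "p \<in> S"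
        using B(3) by blast
    qed
    have "c \<le> emeasure M (T n)" for n
    proof -
      have "P (map k [0..<n]) \<subseteq> T n"
      proof
        fix p
        assume "p \<in> P (map k [0..<n])"
        then obtain \<sigma> where \<sigma>: "\<And>i. i < n \<Longrightarrow> \<sigma> i \<le> k i" "\<And>m. p \<in> B m \<sigma>"
          by (auto simp: P_def)
        define \<tau> where "\<tau> i = (if i < n then \<sigma> i else 0)" for i
        have "\<tau> \<in> K"
          using \<sigma>(1) by (auto simp: K_def \<tau>_def)
        moreover have "p \<in> B m \<tau>" if "m \<le> n" for m
          using \<sigma>(2)[of m] B(2)[of m \<sigma> \<tau>] that by (simp add: \<tau>_def)
        ultimately show "p \<in> T n"
          by (auto simp: T_def)
      qed
      then have "outer_measure_of M (P (map k [0..<n])) \<le> emeasure M (T n)"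
        using outer_measure_of_mono[of "P (map k [0..<n])" "T n" M] T_sets by simp
      then show ?thesis
        using k[of n] by (auto intro: less_imp_le order_less_le_trans)
    qed
    then have "c \<le> (INF n. emeasure M (T n))"
      by (rule INF_greatest)
    also have "\<dots> = emeasure M (\<Inter>n. T n)"
      using T_sets T_dec by (intro INF_emeasure_decseq) auto
    finally show ?thesis
      using T_sub T_sets by (intro bexI[of _ "\<Inter>n. T n"]) auto
  qed
  obtain U where U: "U \<in> sets M" "S \<subseteq> U" "outer_measure_of M S = emeasure M U"
    using outer_measure_of_attain[OF S_space] by blast
  show ?thesis
  proof (cases "emeasure M U = 0")
    case True
    then show ?thesis
      using U by (intro null_sets_completion[of U]) auto
  next
    case False
    then obtain c :: "nat \<Rightarrow> ennreal" where c: "\<And>n. c n < emeasure M U" "c \<longlonglongrightarrow> emeasure M U"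
      using approx_from_below_dense_linorder[of 0 "emeasure M U"] by (auto simp: zero_less_iff_neq_zero)
    have "\<forall>n. \<exists>L\<in>sets M. L \<subseteq> S \<and> c n \<le> emeasure M L"
      using approx c(1) U(3) by simp
    then obtain L where L: "\<And>n. L n \<in> sets M" "\<And>n. L n \<subseteq> S" "\<And>n. c n \<le> emeasure M (L n)"
      by metis
    have UL: "(\<Union>n. L n) \<in> sets M" "(\<Union>n. L n) \<subseteq> S"
      using L by auto
    have "c n \<le> emeasure M (\<Union>n. L n)" for n
      using L(3)[of n] emeasure_mono[of "L n" "\<Union>n. L n" M] UL(1) by (auto intro: order_trans)
    then have "emeasure M U \<le> emeasure M (\<Union>n. L n)"
      using c(2) by (intro LIMSEQ_le_const2) auto
    then have "emeasure M (U - (\<Union>n. L n)) = 0"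
      using UL U by (subst emeasure_Diff) (auto simp: diff_eq_0_iff_ennreal less_top[symmetric])
    then have "U - (\<Union>n. L n) \<in> null_sets M"
      using U UL by auto
    then show ?thesis
      using UL U(2) by (intro sets_completionI[of S "\<Union>n. L n" "S - (\<Union>n. L n)" "U - (\<Union>n. L n)"]) auto
  qed
qed

section \<open>Measurable projections\<close>

text \<open>
  Rectangles with a measurable first side and a closed second side; no topology is needed on the first
  factor.
\<close>

definition closed_rectangles :: "'a measure \<Rightarrow> 'b topology \<Rightarrow> ('a \<times> 'b) set set" where
  "closed_rectangles M T = {A \<times> C | A C. A \<in> sets M \<and> closedin T C}"

lemma closed_rectanglesI: "A \<in> sets M \<Longrightarrow> closedin T C \<Longrightarrow> A \<times> C \<in> closed_rectangles M T"
  by (auto simp: closed_rectangles_def)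

lemma closed_rectangles_top:
  "space M \<times> topspace T \<in> closed_rectangles M T"
  "G \<in> closed_rectangles M T \<Longrightarrow> G \<subseteq> space M \<times> topspace T"
  by (auto simp: closed_rectangles_def dest: sets.sets_into_space closedin_subset)

lemmas souslin_rect_UN = souslin_UN[OF _ closed_rectangles_top]

lemma souslin_rect_Un:
  assumes "A \<in> souslin (closed_rectangles M T)" "B \<in> souslin (closed_rectangles M T)"
  shows "A \<union> B \<in> souslin (closed_rectangles M T)"
proof -
  have "(\<Union>i::nat. if i = 0 then A else B) \<in> souslin (closed_rectangles M T)"
    using assms by (intro souslin_rect_UN) auto
  moreover have "(\<Union>i::nat. if i = 0 then A else B) = A \<union> B"
    by (auto split: if_splits)
  ultimately show ?thesis
    by simp
qed

text \<open>
  The sets that, together with their complement, are Souslin over the closed rectangles form a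
  \<open>\<sigma>\<close>-algebra; it contains the products of measurable with open sets, because open sets of a metrizable
  space are countable unions of closed sets.
\<close>

lemma sets_pair_souslin_rectangles:
  assumes T: "metrizable_space T" "topspace T = space N"
    and sets_N: "sets N = sigma_sets (space N) {U. openin T U}"
    and E: "E \<in> sets (M \<Otimes>\<^sub>M N)"
  shows "E \<in> souslin (closed_rectangles M T)"
proof -
  let ?S = "souslin (closed_rectangles M T)" and ?\<Omega> = "space M \<times> space N"
  let ?E = "{a \<times> b | a b. a \<in> sets M \<and> b \<in> {U. openin T U}}"
  have opens: "{U. openin T U} \<subseteq> Pow (space N)"
    using openin_subset[of T] T(2) by auto
  have "sets (M \<Otimes>\<^sub>M N) = sets (sigma ?\<Omega> ?E)"
    using opens sets_N sets.space_closed[of M] openin_topspace[of T]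
    by (intro sets_pair_eq[where Ca = "{space M}" and Cb = "{space N}"])
      (auto simp: sets.sigma_sets_eq T(2))
  moreover have sub: "?E \<subseteq> Pow ?\<Omega>"
    using opens sets.space_closed[of M] by blast
  ultimately have "E \<in> sigma_sets ?\<Omega> ?E"
    using E by simp
  then have "E \<in> ?S \<and> ?\<Omega> - E \<in> ?S"
  proof induction
    case (Basic G)
    then obtain A U where G: "G = A \<times> U" "A \<in> sets M" "openin T U"
      by blast
    have "fsigma_in T U"
      using open_imp_fsigma_in T(1) G(3) by blast
    then obtain C :: "nat \<Rightarrow> _" where C: "\<And>n. closedin T (C n)" "\<Union> (range C) = U"
      unfolding fsigma_in_ascending by blast
    have "A \<times> C n \<in> ?S" for n
      using G C by (intro souslin_basic closed_rectanglesI)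
    then have "(\<Union>n. A \<times> C n) \<in> ?S"
      by (rule souslin_rect_UN)
    moreover have "(\<Union>n. A \<times> C n) = G"
      using C(2) G(1) by auto
    moreover have "(space M - A) \<times> topspace T \<in> ?S" "space M \<times> (topspace T - U) \<in> ?S"
      using G by (intro souslin_basic closed_rectanglesI; auto)+
    then have "(space M - A) \<times> topspace T \<union> space M \<times> (topspace T - U) \<in> ?S"
      by (rule souslin_rect_Un)
    moreover have "(space M - A) \<times> topspace T \<union> space M \<times> (topspace T - U) = ?\<Omega> - G"
      using G(1) T(2) by auto
    ultimately show ?case
      by simp
  next
    case Empty
    have "{} \<times> topspace T \<in> ?S" "space M \<times> topspace T \<in> ?S"
      by (intro souslin_basic closed_rectanglesI; simp)+
    then have "{} \<in> ?S" "?\<Omega> \<in> ?S"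
      using T(2) by simp_all
    then show ?case
      by simp
  next
    case (Compl G)
    moreover have "?\<Omega> - (?\<Omega> - G) = G"
      using sigma_sets_into_sp[OF sub Compl.hyps] by blast
    ultimately show ?case
      by simp
  next
    case (Union G)
    have "(\<Union>i. G i) \<in> ?S"
      using Union.IH by (intro souslin_rect_UN) simp
    moreover have "(\<Inter>i. ?\<Omega> - G i) \<in> ?S"
      using Union.IH by (intro souslin_INT) simp
    moreover have "(\<Inter>i. ?\<Omega> - G i) = ?\<Omega> - (\<Union>i. G i)"
      by blast
    ultimately show ?case
      by simp
  qed
  then show ?thesis
    by simp
qed

text \<open>
  The existential quantifier over the second coordinate \<open>y\<close> is absorbed into the branch: besides the
  branch of \<open>E\<close> a new branch \<open>\<rho>\<close> records, for each \<open>m\<close>, the index of a point of a countable dense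
  set within \<open>1 / (m + 1)\<close> of \<open>y\<close>. By completeness, such a \<open>y\<close> exists as soon as all the finite
  intersections \<open>F n \<rho>\<close> of closed sets are nonempty, and that condition depends on finitely many
  entries of \<open>\<rho>\<close>.
\<close>

lemma (in Metric_space) projection_souslin:
  fixes N :: "'b measure"
  assumes "mcomplete" and "separable_space mtopology"
    and E: "E \<in> souslin (closed_rectangles N mtopology)"
  shows "fst ` E \<in> souslin (sets N)"
proof (cases "M = {}")
  case True
  obtain B :: "nat \<Rightarrow> (nat \<Rightarrow> nat) \<Rightarrow> ('b \<times> 'a) set"
    where B: "\<And>n \<sigma>. B n \<sigma> \<in> closed_rectangles N mtopology"
      "\<And>p. p \<in> E \<longleftrightarrow> (\<exists>\<sigma>. \<forall>n. p \<in> B n \<sigma>)"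
    using E by (elim souslinE) blast
  have "B n \<sigma> = {}" for n \<sigma>
    using closed_rectangles_top(2)[OF B(1)[of n \<sigma>], unfolded topspace_mtopology] True by simp
  then have "E = {}"
    using B(2) by auto
  then show ?thesis
    using souslin_basic[of "{}" "sets N"] by simp
next
  case False
  obtain Q where Q: "countable Q" "Q \<subseteq> M" "mtopology closure_of Q = M"
    using assms(2) by (auto simp: separable_space_def)
  define q where "q = from_nat_into Q"
  have dense: "\<exists>j. d y (q j) \<le> r" if "y \<in> M" "0 < r" for y r
  proof -
    have "y \<in> mtopology closure_of Q"
      using Q(3) that by simp
    then obtain z where z: "z \<in> Q" "z \<in> mball y r"
      using \<open>0 < r\<close> by (auto simp: metric_closure_of)
    then have "q (to_nat_on Q z) = z"
      using Q(1) by (simp add: q_def)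
    then show ?thesis
      using z(2) by (intro exI[of _ "to_nat_on Q z"]) auto
  qed
  have Q_ne: "Q \<noteq> {}"
    using Q(3) False by auto
  have q_in: "q j \<in> M" for j
    using from_nat_into[OF Q_ne] Q(2) by (auto simp: q_def)
  obtain B where B: "\<And>n \<sigma>. B n \<sigma> \<in> closed_rectangles N mtopology" "finitely_dependent B"
      "\<And>p. p \<in> E \<longleftrightarrow> (\<exists>\<sigma>. \<forall>n. p \<in> B n \<sigma>)"
    using E by (elim souslinE) blast
  have "\<forall>G\<in>closed_rectangles N mtopology. \<exists>A C. G = A \<times> C \<and> A \<in> sets N \<and> closedin mtopology C"
    by (auto simp: closed_rectangles_def)
  then obtain a c where ac: "\<And>G. G \<in> closed_rectangles N mtopology \<Longrightarrow>
      G = a G \<times> c G \<and> a G \<in> sets N \<and> closedin mtopology (c G)"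
    by metis
  have B_iff: "(x, y) \<in> B n \<sigma> \<longleftrightarrow> x \<in> a (B n \<sigma>) \<and> y \<in> c (B n \<sigma>)" for x y n \<sigma>
    using ac[OF B(1)[of n \<sigma>]] by (metis mem_Sigma_iff)
  \<comment> \<open>the even entries of \<open>\<rho>\<close> carry the branch of \<open>E\<close>, the odd ones the approximations of \<open>y\<close>\<close>
  define ev od :: "(nat \<Rightarrow> nat) \<Rightarrow> nat \<Rightarrow> nat"
    where "ev \<rho> i = \<rho> (2 * i)" and "od \<rho> i = \<rho> (2 * i + 1)" for \<rho> i
  define F where "F n \<rho> = (\<Inter>m\<in>{..n}. c (B m (ev \<rho>)) \<inter> mcball (q (od \<rho> m)) (1 / Suc m))" for n \<rho>
  define D where "D n \<rho> = (if F n \<rho> = {} then {} else \<Inter>m\<in>{..n}. a (B m (ev \<rho>)))" for n \<rho>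
  obtain h where h: "\<And>n \<sigma> \<tau>. (\<And>i. i < h n \<Longrightarrow> \<sigma> i = \<tau> i) \<Longrightarrow> B n \<sigma> = B n \<tau>"
    using finitely_dependentD[OF B(2)] by blast
  show ?thesis
  proof (rule souslinI[of D])
    show "D n \<rho> \<in> sets N" for n \<rho>
      using ac B(1) by (auto simp: D_def)
    show "finitely_dependent D"
      unfolding finitely_dependent_def
    proof (intro allI exI impI)
      fix n and \<rho> \<rho>' :: "nat \<Rightarrow> nat"
      let ?H = "2 * (\<Sum>m\<le>n. h m) + 2 * n + 2"
      assume eq: "\<forall>i<?H. \<rho> i = \<rho>' i"
      have "B m (ev \<rho>) = B m (ev \<rho>') \<and> od \<rho> m = od \<rho>' m" if "m \<le> n" for m
      proof
        have "h m \<le> (\<Sum>m\<le>n. h m)"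
          using that by (intro member_le_sum) auto
        then show "B m (ev \<rho>) = B m (ev \<rho>')"
          using eq by (intro h) (auto simp: ev_def)
        show "od \<rho> m = od \<rho>' m"
          using eq that by (simp add: od_def)
      qed
      then show "D n \<rho> = D n \<rho>'"
        by (simp add: D_def F_def)
    qed
    fix x
    show "x \<in> fst ` E \<longleftrightarrow> (\<exists>\<rho>. \<forall>n. x \<in> D n \<rho>)"
    proof
      assume "x \<in> fst ` E"
      then obtain y \<sigma> where y: "\<And>n. (x, y) \<in> B n \<sigma>"
        using B(3) by force
      then have "y \<in> M"
        using closedin_subset ac[OF B(1)] B_iff by (metis subsetD topspace_mtopology)
      then have "\<forall>m. \<exists>j. d y (q j) \<le> 1 / Suc m"
        using dense by simp
      then obtain t where t: "\<And>m. d y (q (t m)) \<le> 1 / Suc m"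
        by metis
      define \<rho> where "\<rho> i = (if even i then \<sigma> (i div 2) else t (i div 2))" for i
      have \<rho>: "ev \<rho> = \<sigma>" "od \<rho> = t"
        by (auto simp: ev_def od_def \<rho>_def)
      have "y \<in> F n \<rho>" for n
        using y t \<open>y \<in> M\<close> q_in B_iff by (auto simp: F_def \<rho> commute)
      then have "F n \<rho> \<noteq> {}" for n
        by blast
      then have "x \<in> D n \<rho>" for n
        using y B_iff by (simp add: D_def \<rho>)
      then show "\<exists>\<rho>. \<forall>n. x \<in> D n \<rho>"
        by blast
    next
      assume "\<exists>\<rho>. \<forall>n. x \<in> D n \<rho>"
      then obtain \<rho> where \<rho>: "\<And>n. x \<in> D n \<rho>"
        by blast
      have nonempty: "F n \<rho> \<noteq> {}" and x: "x \<in> a (B n (ev \<rho>))" for n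
        using \<rho>[of n] by (auto simp: D_def split: if_splits)
      have "\<Inter> (range (\<lambda>n. F n \<rho>)) \<noteq> {}"
      proof (rule \<open>mcomplete\<close>[unfolded mcomplete_nest, rule_format], intro conjI allI impI)
        show "closedin mtopology (F n \<rho>)" for n
          unfolding F_def using ac B(1) by (intro closedin_Inter) auto
        show "decseq (\<lambda>n. F n \<rho>)"
          by (fastforce simp: decseq_def F_def)
        fix \<epsilon> :: real
        assume "0 < \<epsilon>"
        then obtain n where "1 / Suc n < \<epsilon>"
          using nat_approx_posE by blast
        moreover have "F n \<rho> \<subseteq> mcball (q (od \<rho> n)) (1 / Suc n)"
          by (auto simp: F_def)
        ultimately show "\<exists>n z. F n \<rho> \<subseteq> mcball z \<epsilon>"
          by (meson less_imp_le mcball_subset_concentric order_trans)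
      qed (rule nonempty)
      then obtain y where "\<And>n. y \<in> F n \<rho>"
        by auto
      then have "(x, y) \<in> B n (ev \<rho>)" for n
        using x[of n] B_iff by (fastforce simp: F_def)
      then have "(x, y) \<in> E"
        using B(3) by blast
      then show "x \<in> fst ` E"
        by force
    qed
  qed
qed

theorem measurable_projection:
  assumes "finite_measure M" "standard_borel N" "E \<in> sets (M \<Otimes>\<^sub>M N)"
  shows "fst ` E \<in> sets (completion M)"
proof -
  obtain T where T: "completely_metrizable_space T" "separable_space T" "topspace T = space N"
      "sets N = sigma_sets (space N) {U. openin T U}"
    using assms(2) unfolding standard_borel_def by blast
  obtain Y d where Y: "Metric_space Y d" "Metric_space.mcomplete Y d" "T = Metric_space.mtopology Y d"
    using T(1) unfolding completely_metrizable_space_def by blast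
  have "metrizable_space T"
    using T(1) by (rule completely_metrizable_imp_metrizable_space)
  then have "E \<in> souslin (closed_rectangles M T)"
    using sets_pair_souslin_rectangles T assms(3) by blast
  then have "fst ` E \<in> souslin (sets M)"
    using Metric_space.projection_souslin[OF Y(1,2)] T(2) Y(3) by blast
  then show ?thesis
    using souslin_completion assms(1) by blast
qed

section \<open>Measurability of sums over sections\<close>

lemma standard_borel_separating:
  assumes "standard_borel N"
  obtains U :: "nat \<Rightarrow> 'a set" where "\<And>i. U i \<in> sets N"
    "\<And>x y. x \<in> space N \<Longrightarrow> y \<in> space N \<Longrightarrow> x \<noteq> y \<Longrightarrow> \<exists>i. x \<in> U i \<and> y \<notin> U i"
proof -
  obtain T where T: "completely_metrizable_space T" "separable_space T" "topspace T = space N"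
      "sets N = sigma_sets (space N) {U. openin T U}"
    using assms unfolding standard_borel_def by blast
  obtain Y d where Y: "Metric_space Y d" "T = Metric_space.mtopology Y d"
    using T(1) unfolding completely_metrizable_space_def by blast
  interpret Metric_space Y d
    by (fact Y(1))
  have Y_space: "Y = space N"
    using T(3) Y(2) by simp
  have open_sets: "U \<in> sets N" if "openin mtopology U" for U
    using that T(4) Y(2) by auto
  obtain Q where Q: "countable Q" "Q \<subseteq> Y" "mtopology closure_of Q = Y"
    using T(2) Y(2) by (auto simp: separable_space_def)
  define U where "U i = (case prod_decode i of (j, m) \<Rightarrow> mball (from_nat_into Q j) (1 / Suc m))" for i
  show ?thesis
  proof (rule that[of U])
    show "U i \<in> sets N" for i
      by (auto simp: U_def split: prod.splits intro!: open_sets)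
    fix x y
    assume xy: "x \<in> space N" "y \<in> space N" "x \<noteq> y"
    have pos: "0 < d x y / 2"
      using xy Y_space by simp
    obtain m where m: "1 / Suc m < d x y / 2"
      using nat_approx_posE[OF pos] by blast
    have "x \<in> mtopology closure_of Q"
      using Q(3) xy(1) Y_space by simp
    moreover have xy_in: "x \<in> Y" "y \<in> Y"
      using xy Y_space by simp_all
    ultimately have "\<exists>z\<in>Q. z \<in> mball x (1 / Suc m)"
      by (simp only: metric_closure_of mem_Collect_eq) simp
    then obtain z where z: "z \<in> Q" "d x z < 1 / Suc m"
      by auto
    have z_in: "z \<in> Y"
      using z(1) Q(2) by blast
    have U_eq: "U (prod_encode (to_nat_on Q z, m)) = mball z (1 / Suc m)"
      using Q(1) z(1) by (simp add: U_def)
    have "x \<in> mball z (1 / Suc m)"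
      using z(2) z_in xy_in by (simp add: commute)
    moreover have "y \<notin> mball z (1 / Suc m)"
    proof
      assume "y \<in> mball z (1 / Suc m)"
      then have "d z y < 1 / Suc m"
        by simp
      moreover have "d x y \<le> d x z + d z y"
        using triangle xy z_in Y_space by blast
      ultimately show False
        using z(2) m by linarith
    qed
    ultimately show "\<exists>i. x \<in> U i \<and> y \<notin> U i"
      using U_eq by metis
  qed
qed

text \<open>
  With a sequence of measurable sets \<open>U i\<close> that separates points, the number of points of a section is
  the supremum over \<open>n\<close> of the number of cells of the partition generated by the sets
  \<open>U i\<close> with \<open>i < n\<close> that the section meets. The set of all \<open>x\<close> whose section meets a given cell is a
  projection. No countability of the sections is needed.
\<close>

lemma measurable_section_count:
  assumes M: "finite_measure M" and N: "standard_borel N" and E: "E \<in> sets (M \<Otimes>\<^sub>M N)"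
  shows "(\<lambda>x. emeasure (count_space UNIV) (Pair x -` E)) \<in> borel_measurable (completion M)"
proof -
  obtain U where U[measurable]: "\<And>i::nat. U i \<in> sets N"
    and sep: "\<And>x y. x \<in> space N \<Longrightarrow> y \<in> space N \<Longrightarrow> x \<noteq> y \<Longrightarrow> \<exists>i. x \<in> U i \<and> y \<notin> U i"
    using standard_borel_separating[OF N] by metis
  \<comment> \<open>\<open>c n y\<close> names the cell of \<open>y\<close> in the \<open>n\<close>-th partition\<close>
  define c where "c n y = {i. i < n \<and> y \<in> U i}" for n :: nat and y
  define P where "P n I = fst ` {p \<in> E. c n (snd p) = I}" for n I
  have P_sets: "P n I \<in> sets (completion M)" for n I
  proof -
    have "{p \<in> E. c n (snd p) = I} = {p \<in> space (M \<Otimes>\<^sub>M N). p \<in> E \<and>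
        (\<forall>i. i \<in> I \<longleftrightarrow> i < n \<and> snd p \<in> U i)}"
      using sets.sets_into_space[OF E] by (auto simp: c_def)
    also have "\<dots> \<in> sets (M \<Otimes>\<^sub>M N)"
      using E by measurable
    finally show ?thesis
      unfolding P_def using measurable_projection[OF M N] by blast
  qed
  have count: "emeasure (count_space UNIV) (Pair x -` E) = (SUP n. \<Sum>I\<in>Pow {..<n}. indicator (P n I) x)"
    for x
  proof -
    let ?S = "Pair x -` E"
    have S_space: "?S \<subseteq> space N"
      using sets.sets_into_space[OF E] by (auto simp: space_pair_measure)
    have c_fin: "finite (c n ` S)" for n S
      by (rule finite_subset[of _ "Pow {..<n}"]) (auto simp: c_def)
    have "(\<Sum>I\<in>Pow {..<n}. indicator (P n I) x) = (of_nat (card (c n ` ?S)) :: ennreal)" for n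
    proof -
      have "c n ` ?S \<subseteq> Pow {..<n}"
        by (auto simp: c_def)
      moreover have "x \<in> P n I \<longleftrightarrow> I \<in> c n ` ?S" for I
        by (force simp: P_def)
      then have "indicator (P n I) x = (indicator (c n ` ?S) I :: ennreal)" for I
        by (simp add: indicator_def)
      ultimately show ?thesis
        by (simp add: indicator_def sum.If_cases Int_absorb1)
    qed
    moreover have "emeasure (count_space UNIV) ?S = (SUP n. of_nat (card (c n ` ?S)))"
    proof (rule antisym)
      show "(SUP n. of_nat (card (c n ` ?S))) \<le> emeasure (count_space UNIV) ?S"
      proof (rule SUP_least)
        fix n
        show "of_nat (card (c n ` ?S)) \<le> emeasure (count_space UNIV) ?S"
          by (cases "finite ?S") (auto simp: card_image_le)
      qed
      have card_le: "of_nat (card F) \<le> (SUP n. of_nat (card (c n ` ?S)) :: ennreal)"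
        if F: "finite F" "F \<subseteq> ?S" for F
      proof -
        have "\<forall>y\<in>F. \<forall>z\<in>F. \<exists>i. y \<noteq> z \<longrightarrow> y \<in> U i \<and> z \<notin> U i"
          using sep F(2) S_space by blast
        then obtain w where w: "\<And>y z. y \<in> F \<Longrightarrow> z \<in> F \<Longrightarrow> y \<noteq> z \<Longrightarrow> y \<in> U (w y z) \<and> z \<notin> U (w y z)"
          by metis
        define n where "n = Suc (Max ((\<lambda>(y, z). w y z) ` (F \<times> F)))"
        have "w y z < n" if "y \<in> F" "z \<in> F" for y z
          unfolding n_def less_Suc_eq_le using that F(1) by (intro Max_ge) auto
        then have "inj_on (c n) F"
          using w unfolding inj_on_def c_def by blast
        then have "card F = card (c n ` F)"
          by (simp add: card_image)
        also have "\<dots> \<le> card (c n ` ?S)"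
          using F(2) c_fin by (intro card_mono) auto
        finally show ?thesis
          by (intro SUP_upper2[of n]) auto
      qed
      show "emeasure (count_space UNIV) ?S \<le> (SUP n. of_nat (card (c n ` ?S)))"
      proof (cases "finite ?S")
        case False
        have "of_nat m \<le> (SUP n. of_nat (card (c n ` ?S)) :: ennreal)" for m
          using infinite_arbitrarily_large[OF False, of m] card_le by metis
        then have "(SUP m. of_nat m) \<le> (SUP n. of_nat (card (c n ` ?S)) :: ennreal)"
          by (rule SUP_least)
        then have "(SUP n. of_nat (card (c n ` ?S)) :: ennreal) = top"
          by (simp only: ennreal_SUP_of_nat_eq_top top_unique)
        then show ?thesis
          by (simp only: top_greatest)
      qed (use card_le in auto)
    qed
    ultimately show ?thesis
      by simp
  qed
  show ?thesis
    unfolding count using P_sets by measurable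
qed

lemma measurable_section_sum:
  fixes g :: "'a \<times> 'b \<Rightarrow> ennreal"
  assumes M: "finite_measure M" and N: "standard_borel N" and g: "g \<in> borel_measurable (M \<Otimes>\<^sub>M N)"
  shows "(\<lambda>x. \<integral>\<^sup>+y. g (x, y) \<partial>count_space (space N)) \<in> borel_measurable (completion M)"
  using g
proof (induction rule: borel_measurable_induct)
  case (cong f g)
  have "(\<integral>\<^sup>+y. f (x, y) \<partial>count_space (space N)) = (\<integral>\<^sup>+y. g (x, y) \<partial>count_space (space N))"
    if "x \<in> space M" for x
    using cong(3) that by (intro nn_integral_cong) (simp add: space_pair_measure)
  then show ?case
    using cong(4) by (subst measurable_cong[where g = "\<lambda>x. \<integral>\<^sup>+y. g (x, y) \<partial>count_space (space N)"]) simp_all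
next
  case (set E)
  have "(\<integral>\<^sup>+y. indicator E (x, y) \<partial>count_space (space N)) = emeasure (count_space UNIV) (Pair x -` E)" for x
  proof -
    have sub: "Pair x -` E \<subseteq> space N"
      using sets.sets_into_space[OF set] by (auto simp: space_pair_measure)
    have "(\<integral>\<^sup>+y. indicator E (x, y) \<partial>count_space (space N)) =
        (\<integral>\<^sup>+y. indicator (Pair x -` E) y \<partial>count_space (space N))"
      by (simp add: indicator_def)
    also have "\<dots> = emeasure (count_space (space N)) (Pair x -` E)"
      using sub by simp
    also have "\<dots> = emeasure (count_space UNIV) (Pair x -` E)"
      using sub by (simp add: emeasure_count_space)
    finally show ?thesis .
  qed
  then show ?case
    using measurable_section_count[OF M N set] by simp
next
  case (mult u c)
  then show ?case
    by (simp add: nn_integral_cmult)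
next
  case (add u v)
  then show ?case
    by (simp add: nn_integral_add)
next
  case (seq U)
  have "(\<integral>\<^sup>+y. (SUP i. U i) (x, y) \<partial>count_space (space N)) =
      (SUP i. \<integral>\<^sup>+y. U i (x, y) \<partial>count_space (space N))" for x
    unfolding SUP_apply using \<open>incseq U\<close>
    by (intro nn_integral_monotone_convergence_SUP) (auto simp: incseq_def le_fun_def)
  then show ?case
    using seq.IH by simp
qed

section \<open>Measure-preserving equivalence relations and mass transport\<close>

lemma infsum_ennreal_eq_nn_integral:
  fixes g :: "'a \<Rightarrow> ennreal"
  assumes "countable A"
  shows "(\<Sum>\<^sub>\<infinity>x\<in>A. g x) = (\<integral>\<^sup>+x. g x \<partial>count_space A)"
proof (rule antisym)
  have sup: "(\<Sum>\<^sub>\<infinity>x\<in>A. g x) = (SUP F\<in>{F. finite F \<and> F \<subseteq> A}. sum g F)"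
    by (rule nonneg_infsum_complete) simp
  show "(\<Sum>\<^sub>\<infinity>x\<in>A. g x) \<le> (\<integral>\<^sup>+x. g x \<partial>count_space A)"
    unfolding sup
  proof (rule SUP_least)
    fix F
    assume F: "F \<in> {F. finite F \<and> F \<subseteq> A}"
    then have "sum g F = (\<integral>\<^sup>+x. g x * indicator F x \<partial>count_space A)"
      by (subst nn_integral_count_space'[of F]) auto
    also have "\<dots> \<le> (\<integral>\<^sup>+x. g x \<partial>count_space A)"
      by (intro nn_integral_mono) (simp split: split_indicator)
    finally show "sum g F \<le> (\<integral>\<^sup>+x. g x \<partial>count_space A)" .
  qed
  define S where "S n = {x \<in> A. to_nat_on A x < n}" for n
  have S: "finite (S n)" "S n \<subseteq> A" for n
  proof -
    have "inj_on (to_nat_on A) (S n)"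
      using inj_on_to_nat_on[OF assms] by (rule inj_on_subset) (auto simp: S_def)
    then show "finite (S n)"
      by (rule inj_on_finite[of _ _ "{..<n}"]) (auto simp: S_def)
  qed (auto simp: S_def)
  have "(\<integral>\<^sup>+x. g x \<partial>count_space A) = (\<integral>\<^sup>+x. (SUP n. g x * indicator (S n) x) \<partial>count_space A)"
  proof (rule nn_integral_cong)
    fix x
    assume "x \<in> space (count_space A)"
    then have "x \<in> S (Suc (to_nat_on A x))"
      by (simp add: S_def)
    then have "g x \<le> (SUP n. g x * indicator (S n) x)"
      by (intro SUP_upper2[of "Suc (to_nat_on A x)"]) auto
    moreover have "(SUP n. g x * indicator (S n) x) \<le> g x"
      by (intro SUP_least) (simp split: split_indicator)
    ultimately show "g x = (SUP n. g x * indicator (S n) x)"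
      by (rule antisym)
  qed
  also have "\<dots> = (SUP n. \<integral>\<^sup>+x. g x * indicator (S n) x \<partial>count_space A)"
    by (intro nn_integral_monotone_convergence_SUP)
      (auto simp: incseq_def le_fun_def S_def split: split_indicator)
  also have "\<dots> \<le> (SUP F\<in>{F. finite F \<and> F \<subseteq> A}. sum g F)"
  proof (rule SUP_least)
    fix n
    have "(\<integral>\<^sup>+x. g x * indicator (S n) x \<partial>count_space A) = sum g (S n)"
      using S by (subst nn_integral_count_space'[of "S n"]) auto
    also have "\<dots> \<le> (SUP F\<in>{F. finite F \<and> F \<subseteq> A}. sum g F)"
      using S by (intro SUP_upper) auto
    finally show "(\<integral>\<^sup>+x. g x * indicator (S n) x \<partial>count_space A) \<le> \<dots>" .
  qed
  finally show "(\<integral>\<^sup>+x. g x \<partial>count_space A) \<le> (\<Sum>\<^sub>\<infinity>x\<in>A. g x)"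
    unfolding sup .
qed

text \<open>A discrete measure-preserving equivalence relation over a standard probability space.\<close>

locale pmp_relation =
  fixes M :: "'a measure" and R :: "('a \<times> 'a) set"
  assumes standard: "standard_prob_space M"
    and discrete: "discrete_equiv_rel M R"
    and preserving: "measure_preserving_rel M R"
begin

sublocale prob_space M
  using standard by (simp add: standard_prob_space_def)

text \<open>
  The sum over the class of \<open>x\<close>, written as an integral over counting measure so that the theorems of
  integration theory apply. It agrees with \<^const>\<open>class_sum\<close> whenever the class is countable.
\<close>

definition orbit_sum :: "('a \<times> 'a \<Rightarrow> ennreal) \<Rightarrow> 'a \<Rightarrow> ennreal" where
  "orbit_sum g x = (\<integral>\<^sup>+y. g (x, y) \<partial>count_space (R `` {x}))"

lemma standard_borel: "standard_borel M"
  using standard by (simp add: standard_prob_space_def)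

lemma R_sets: "R \<in> sets (M \<Otimes>\<^sub>M M)"
  and R_equiv: "equiv (space M) R"
  and AE_countable_class: "AE x in M. countable (R `` {x})"
  using discrete by (simp_all add: discrete_equiv_rel_def)

lemma R_space: "(x, y) \<in> R \<Longrightarrow> x \<in> space M \<and> y \<in> space M"
  using sets.sets_into_space[OF R_sets] by (auto simp: space_pair_measure)

lemma R_sym: "(x, y) \<in> R \<Longrightarrow> (y, x) \<in> R"
  using R_equiv by (auto elim: equivE dest: symD)

lemma class_eq: "(x, y) \<in> R \<Longrightarrow> R `` {y} = R `` {x}"
  using equiv_class_eq[OF R_equiv] by simp

lemma sets_restrict_R: "E \<in> sets (restrict_space (M \<Otimes>\<^sub>M M) R) \<longleftrightarrow> E \<subseteq> R \<and> E \<in> sets (M \<Otimes>\<^sub>M M)"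
  using R_sets by (subst sets_restrict_space_iff) auto

lemma space_restrict_R: "space (restrict_space (M \<Otimes>\<^sub>M M) R) = R"
  using sets.sets_into_space[OF R_sets] by (auto simp: space_restrict_space)

lemma sigma_algebra_R: "sigma_algebra R (sets (restrict_space (M \<Otimes>\<^sub>M M) R))"
  using sets.sigma_algebra_axioms[of "restrict_space (M \<Otimes>\<^sub>M M) R"] by (simp only: space_restrict_R)

lemma sets_rel: "sets (rel_measure M R) = sets (restrict_space (M \<Otimes>\<^sub>M M) R)"
  unfolding rel_measure_def using sigma_algebra.sets_measure_of_eq[OF sigma_algebra_R] by blast

lemma space_rel: "space (rel_measure M R) = R"
  using sets_eq_imp_space_eq[OF sets_rel] space_restrict_R by simp

text \<open>
  The set function that defines \<^const>\<open>rel_measure\<close> is countably additive, since the integrands are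
  measurable with respect to the completion of \<open>M\<close>.
\<close>

lemma emeasure_rel:
  assumes "E \<in> sets (rel_measure M R)"
  shows "emeasure (rel_measure M R) E = (\<integral>\<^sup>+x. emeasure (count_space UNIV) {y. (x, y) \<in> E} \<partial>M)"
  unfolding rel_measure_def
proof (rule emeasure_measure_of_sigma[OF sigma_algebra_R])
  let ?S = "sets (restrict_space (M \<Otimes>\<^sub>M M) R)"
  let ?\<mu> = "\<lambda>E. \<integral>\<^sup>+x. emeasure (count_space UNIV) {y. (x, y) \<in> E} \<partial>M"
  show "positive ?S ?\<mu>"
    by (simp add: positive_def)
  show "countably_additive ?S ?\<mu>"
  proof (rule countably_additiveI)
    fix A :: "nat \<Rightarrow> ('a \<times> 'a) set"
    assume A: "range A \<subseteq> ?S" "disjoint_family A"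
    have meas: "(\<lambda>x. emeasure (count_space UNIV) {y. (x, y) \<in> A i}) \<in> borel_measurable (completion M)" for i
    proof -
      have "A i \<in> sets (M \<Otimes>\<^sub>M M)"
        using A(1) sets_restrict_R by blast
      then have "(\<lambda>x. emeasure (count_space UNIV) (Pair x -` A i)) \<in> borel_measurable (completion M)"
        using measurable_section_count[OF finite_measure_axioms standard_borel] by blast
      then show ?thesis
        by (simp add: vimage_def)
    qed
    have "(\<Sum>i. ?\<mu> (A i)) =
        (\<Sum>i. \<integral>\<^sup>+x. emeasure (count_space UNIV) {y. (x, y) \<in> A i} \<partial>completion M)"
      by (simp only: nn_integral_completion)
    also have "\<dots> = (\<integral>\<^sup>+x. (\<Sum>i. emeasure (count_space UNIV) {y. (x, y) \<in> A i}) \<partial>completion M)"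
      using meas by (intro nn_integral_suminf[symmetric])
    also have "\<dots> = (\<integral>\<^sup>+x. emeasure (count_space UNIV) {y. (x, y) \<in> \<Union> (range A)} \<partial>completion M)"
    proof (rule nn_integral_cong)
      fix x
      have "disjoint_family (\<lambda>i. {y. (x, y) \<in> A i})"
        using A(2) unfolding disjoint_family_on_def by blast
      then have "(\<Sum>i. emeasure (count_space UNIV) {y. (x, y) \<in> A i}) =
          emeasure (count_space UNIV) (\<Union>i. {y. (x, y) \<in> A i})"
        by (intro suminf_emeasure) auto
      also have "(\<Union>i. {y. (x, y) \<in> A i}) = {y. (x, y) \<in> \<Union> (range A)}"
        by blast
      finally show "(\<Sum>i. emeasure (count_space UNIV) {y. (x, y) \<in> A i}) =
          emeasure (count_space UNIV) {y. (x, y) \<in> \<Union> (range A)}" .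
    qed
    finally show "(\<Sum>i. ?\<mu> (A i)) = ?\<mu> (\<Union> (range A))"
      by (simp only: nn_integral_completion)
  qed
  show "E \<in> ?S"
    using assms sets_rel by simp
qed

lemma orbit_sum_measurable:
  assumes "g \<in> borel_measurable (rel_measure M R)"
  shows "orbit_sum g \<in> borel_measurable (completion M)"
proof -
  have "g \<in> borel_measurable (restrict_space (M \<Otimes>\<^sub>M M) R)"
    using assms measurable_cong_sets[OF sets_rel refl] by blast
  then have "(\<lambda>p. g p * indicator R p) \<in> borel_measurable (M \<Otimes>\<^sub>M M)"
    using R_sets by (subst (asm) borel_measurable_restrict_space_iff_ennreal) auto
  then have "(\<lambda>x. \<integral>\<^sup>+y. g (x, y) * indicator R (x, y) \<partial>count_space (space M))
      \<in> borel_measurable (completion M)"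
    using measurable_section_sum[OF finite_measure_axioms standard_borel] by blast
  moreover have "(\<integral>\<^sup>+y. g (x, y) * indicator R (x, y) \<partial>count_space (space M)) = orbit_sum g x" for x
  proof -
    have "(\<integral>\<^sup>+y. g (x, y) * indicator R (x, y) \<partial>count_space (space M)) =
        (\<integral>\<^sup>+y. g (x, y) * indicator R (x, y) \<partial>count_space (R `` {x}))"
      using R_space by (intro nn_integral_count_space_eq) auto
    also have "\<dots> = orbit_sum g x"
      unfolding orbit_sum_def by (intro nn_integral_cong) simp
    finally show ?thesis .
  qed
  ultimately show ?thesis
    by simp
qed

lemma nn_integral_rel:
  assumes "g \<in> borel_measurable (rel_measure M R)"
  shows "(\<integral>\<^sup>+p. g p \<partial>rel_measure M R) = (\<integral>\<^sup>+x. orbit_sum g x \<partial>M)"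
  using assms
proof (induction rule: borel_measurable_induct)
  case (cong f g)
  have "orbit_sum f x = orbit_sum g x" for x
    unfolding orbit_sum_def using cong(3) by (intro nn_integral_cong) (simp add: space_rel)
  moreover have "(\<integral>\<^sup>+p. f p \<partial>rel_measure M R) = (\<integral>\<^sup>+p. g p \<partial>rel_measure M R)"
    using cong(3) by (rule nn_integral_cong)
  ultimately show ?case
    using cong(4) by simp
next
  case (set E)
  have "orbit_sum (indicator E) x = emeasure (count_space UNIV) {y. (x, y) \<in> E}" for x
  proof -
    have sub: "{y. (x, y) \<in> E} \<subseteq> R `` {x}"
      using set sets_rel sets_restrict_R by auto
    have "orbit_sum (indicator E) x = (\<integral>\<^sup>+y. indicator {y. (x, y) \<in> E} y \<partial>count_space (R `` {x}))"
      by (simp add: orbit_sum_def indicator_def)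
    also have "\<dots> = emeasure (count_space (R `` {x})) {y. (x, y) \<in> E}"
      using sub by simp
    also have "\<dots> = emeasure (count_space UNIV) {y. (x, y) \<in> E}"
      using sub by (simp add: emeasure_count_space)
    finally show ?thesis .
  qed
  then show ?case
    using set emeasure_rel by simp
next
  case (mult u c)
  have "orbit_sum (\<lambda>p. c * u p) x = c * orbit_sum u x" for x
    by (simp add: orbit_sum_def nn_integral_cmult)
  then have "(\<integral>\<^sup>+x. orbit_sum (\<lambda>p. c * u p) x \<partial>M) = c * (\<integral>\<^sup>+x. orbit_sum u x \<partial>M)"
    using nn_integral_cmult[OF orbit_sum_measurable[OF mult(2)]] by (simp add: nn_integral_completion)
  then show ?case
    using mult by (simp add: nn_integral_cmult)
next
  case (add u v)
  have "orbit_sum (\<lambda>p. v p + u p) x = orbit_sum v x + orbit_sum u x" for x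
    by (simp add: orbit_sum_def nn_integral_add)
  then have "(\<integral>\<^sup>+x. orbit_sum (\<lambda>p. v p + u p) x \<partial>M) =
      (\<integral>\<^sup>+x. orbit_sum v x \<partial>M) + (\<integral>\<^sup>+x. orbit_sum u x \<partial>M)"
    using nn_integral_add[OF orbit_sum_measurable[OF \<open>v \<in> _\<close>] orbit_sum_measurable[OF \<open>u \<in> _\<close>]]
    by (simp add: nn_integral_completion)
  then show ?case
    using add by (simp add: nn_integral_add)
next
  case (seq U)
  have "orbit_sum (SUP i. U i) x = (SUP i. orbit_sum (U i) x)" for x
    unfolding orbit_sum_def SUP_apply using \<open>incseq U\<close>
    by (intro nn_integral_monotone_convergence_SUP) (auto simp: incseq_def le_fun_def)
  moreover have "incseq (\<lambda>i. orbit_sum (U i))"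
    using \<open>incseq U\<close> by (auto simp: incseq_def le_fun_def orbit_sum_def intro!: nn_integral_mono)
  then have "(\<integral>\<^sup>+x. (SUP i. orbit_sum (U i) x) \<partial>completion M) =
      (SUP i. \<integral>\<^sup>+x. orbit_sum (U i) x \<partial>completion M)"
    using orbit_sum_measurable[OF seq(1)] by (intro nn_integral_monotone_convergence_SUP)
  ultimately have "(\<integral>\<^sup>+x. orbit_sum (SUP i. U i) x \<partial>M) = (SUP i. \<integral>\<^sup>+x. orbit_sum (U i) x \<partial>M)"
    by (simp add: nn_integral_completion)
  also have "\<dots> = (SUP i. \<integral>\<^sup>+p. U i p \<partial>rel_measure M R)"
    using seq.IH by simp
  also have "\<dots> = (\<integral>\<^sup>+p. (SUP i. U i) p \<partial>rel_measure M R)"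
    unfolding SUP_apply using seq(1) \<open>incseq U\<close> by (intro nn_integral_monotone_convergence_SUP[symmetric])
  finally show ?case
    by (rule sym)
qed

lemma measurable_swap_rel: "(\<lambda>(x, y). (y, x)) \<in> measurable (rel_measure M R) (rel_measure M R)"
proof -
  have "(\<lambda>(x, y). (y, x)) \<in> measurable (M \<Otimes>\<^sub>M M) (M \<Otimes>\<^sub>M M)"
    by measurable
  then have "(\<lambda>(x, y). (y, x)) \<in>
      measurable (restrict_space (M \<Otimes>\<^sub>M M) R) (restrict_space (M \<Otimes>\<^sub>M M) R)"
    using R_sym by (intro measurable_restrict_space3) auto
  then show ?thesis
    using measurable_cong_sets[OF sets_rel sets_rel] by blast
qed

lemma mass_transport:
  assumes g: "g \<in> borel_measurable (rel_measure M R)"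
  shows "(\<integral>\<^sup>+x. orbit_sum g x \<partial>M) = (\<integral>\<^sup>+x. orbit_sum (\<lambda>(x, y). g (y, x)) x \<partial>M)"
proof -
  have g': "(\<lambda>p. g (case p of (x, y) \<Rightarrow> (y, x))) \<in> borel_measurable (rel_measure M R)"
    using measurable_compose[OF measurable_swap_rel g] .
  have "(\<integral>\<^sup>+x. orbit_sum g x \<partial>M) =
      (\<integral>\<^sup>+p. g p \<partial>distr (rel_measure M R) (rel_measure M R) (\<lambda>(x, y). (y, x)))"
    using preserving nn_integral_rel[OF g] by (simp add: measure_preserving_rel_def)
  also have "\<dots> = (\<integral>\<^sup>+p. g (case p of (x, y) \<Rightarrow> (y, x)) \<partial>rel_measure M R)"
    using measurable_swap_rel g by (subst nn_integral_distr) simp_all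
  also have "\<dots> = (\<integral>\<^sup>+x. orbit_sum (\<lambda>p. g (case p of (x, y) \<Rightarrow> (y, x))) x \<partial>M)"
    using nn_integral_rel[OF g'] .
  finally show ?thesis
    by (simp add: case_prod_unfold)
qed

lemma AE_orbit_zero:
  assumes g: "g \<in> borel_measurable (rel_measure M R)" and "(\<integral>\<^sup>+x. orbit_sum g x \<partial>M) = 0"
  shows "AE x in M. \<forall>y\<in>R `` {x}. g (x, y) = 0"
proof -
  have "(\<integral>\<^sup>+x. orbit_sum g x \<partial>completion M) = 0"
    using assms(2) by (simp add: nn_integral_completion)
  then have "AE x in completion M. orbit_sum g x = 0"
    using orbit_sum_measurable[OF g] by (subst (asm) nn_integral_0_iff_AE) auto
  then have "AE x in M. orbit_sum g x = 0"
    by (simp add: AE_completion_iff)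
  then show ?thesis
    by eventually_elim (simp add: orbit_sum_def nn_integral_0_iff_AE AE_count_space)
qed

lemma AE_rel_imp_AE_class:
  assumes "AE p in rel_measure M R. P p"
  shows "AE x in M. \<forall>y\<in>R `` {x}. P (x, y)"
proof -
  obtain N where N: "{p \<in> space (rel_measure M R). \<not> P p} \<subseteq> N"
      "N \<in> sets (rel_measure M R)" "emeasure (rel_measure M R) N = 0"
    using assms by (auto elim: AE_E)
  have "(\<integral>\<^sup>+x. orbit_sum (indicator N) x \<partial>M) = 0"
    using nn_integral_rel[of "indicator N"] N by simp
  then have "AE x in M. \<forall>y\<in>R `` {x}. indicator N (x, y) = (0::ennreal)"
    using N(2) by (intro AE_orbit_zero) auto
  then show ?thesis
    by eventually_elim (use N(1) in \<open>auto simp: space_rel indicator_def split: if_splits\<close>)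
qed

lemma borel_measurable_fst_rel: "(\<lambda>p. fst p) \<in> measurable (rel_measure M R) M"
  and borel_measurable_snd_rel: "(\<lambda>p. snd p) \<in> measurable (rel_measure M R) M"
  using measurable_cong_sets[OF sets_rel refl] measurable_restrict_space1[of _ "M \<Otimes>\<^sub>M M"]
    measurable_fst[of M M] measurable_snd[of M M] by blast+

text \<open>The saturation of a null set is a null set.\<close>

lemma AE_saturate:
  assumes "AE x in M. P x"
  shows "AE x in M. \<forall>y\<in>R `` {x}. P y"
proof -
  obtain N where N: "{x \<in> space M. \<not> P x} \<subseteq> N" "N \<in> sets M" "emeasure M N = 0"
    using assms by (auto elim: AE_E)
  have meas: "(\<lambda>p. indicator N (snd p)) \<in> borel_measurable (rel_measure M R)"
    using measurable_compose[OF borel_measurable_snd_rel borel_measurable_indicator[OF N(2)]] .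
  have "(\<integral>\<^sup>+x. orbit_sum (\<lambda>p. indicator N (snd p)) x \<partial>M) =
      (\<integral>\<^sup>+x. orbit_sum (\<lambda>p. indicator N (fst p)) x \<partial>M)"
    using mass_transport[OF meas] by (simp add: case_prod_unfold)
  also have "\<dots> = (\<integral>\<^sup>+x. 0 \<partial>M)"
  proof (rule nn_integral_cong_AE)
    have "AE x in M. x \<notin> N"
      using N by (intro AE_not_in) auto
    then show "AE x in M. orbit_sum (\<lambda>p. indicator N (fst p)) x = 0"
      by eventually_elim (simp add: orbit_sum_def)
  qed
  finally have "AE x in M. \<forall>y\<in>R `` {x}. indicator N (snd (x, y)) = (0::ennreal)"
    using meas by (intro AE_orbit_zero) auto
  then show ?thesis
    by eventually_elim (use N(1) R_space in \<open>auto simp: indicator_def split: if_splits\<close>)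
qed

lemma AE_class_sum: "AE x in M. \<forall>g. class_sum R g x = orbit_sum g x"
  using AE_countable_class
  by eventually_elim (simp add: class_sum_def orbit_sum_def infsum_ennreal_eq_nn_integral)

end

section \<open>Almost superadditive sequences and auxiliary limits\<close>

text \<open>
  A variant of Fekete's lemma. The hypothesis bounds \<open>b\<close> from below along \<open>k + 2 * l\<close>, up to an error of
  order \<open>sqrt (k + l)\<close>. Building the multiples \<open>j * m\<close> through the binary expansion of \<open>j\<close>, that is
  \<open>j = e + 2 * i\<close> with \<open>e \<in> {0, 1}\<close>, the accumulated error stays linear in \<open>j\<close>. The correction
  \<open>sqrt j\<close> makes the induction close; the constant \<open>6\<close> is large enough because of
  \<open>sqrt (i + 1) \<le> 3 / 2 * sqrt i\<close> and \<open>sqrt (2 * i + 1) \<le> 7 / 4 * sqrt i\<close>.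
\<close>

lemma almost_superadditive_multiple:
  fixes b :: "nat \<Rightarrow> real"
  assumes C: "0 \<le> C" and b0: "b 0 = 0"
    and step: "\<And>k l. 1 \<le> l \<Longrightarrow> b k + 2 * b l \<le> b (k + 2 * l) + C * sqrt (real (k + l))"
    and m: "1 \<le> m" and j: "1 \<le> j"
  shows "real j * b m - 6 * C * sqrt m * (j - sqrt j) \<le> b (j * m)"
  using j
proof (induction j rule: less_induct)
  case (less j)
  show ?case
  proof (cases "j = 1")
    case False
    define i e where "i = j div 2" and "e = j mod 2"
    have j: "j = 2 * i + e"
      by (simp add: i_def e_def)
    have i: "1 \<le> i" "i < j"
      using less.prems False by (auto simp: i_def)
    have e: "e = 0 \<or> e = 1"
      by (auto simp: e_def)
    have "b (e * m) = real e * b m"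
      using e b0 by auto
    moreover have "b (e * m) + 2 * b (i * m) \<le> b (j * m) + C * sqrt (real (e * m + i * m))"
      using step[of "i * m" "e * m"] i(1) m by (simp add: j algebra_simps)
    moreover have "real i * b m - 6 * C * sqrt m * (i - sqrt i) \<le> b (i * m)"
      using less.IH i by simp
    moreover have "C * sqrt (real (e * m + i * m)) \<le> C * (sqrt m * (3 / 2 * sqrt i))"
    proof -
      have eq: "real (e * m + i * m) = real m * real (e + i)"
        by (simp add: algebra_simps)
      have "sqrt (real (e + i)) \<le> sqrt ((3 / 2)\<^sup>2 * real i)"
        using e i(1) by (intro real_sqrt_le_mono) (auto simp: power2_eq_square)
      then have "sqrt (real (e + i)) \<le> 3 / 2 * sqrt i"
        by (simp add: real_sqrt_mult)
      then show ?thesis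
        unfolding eq real_sqrt_mult using C by (intro mult_left_mono) auto
    qed
    moreover have "C * sqrt m * (6 * (2 * (i - sqrt i)) + 3 / 2 * sqrt i) \<le> C * sqrt m * (6 * (j - sqrt j))"
    proof (intro mult_left_mono)
      have "sqrt j \<le> sqrt ((7 / 4)\<^sup>2 * real i) + e"
      proof -
        have "sqrt j \<le> sqrt ((7 / 4)\<^sup>2 * real i)"
          using e i(1) by (intro real_sqrt_le_mono) (auto simp: j power2_eq_square)
        then show ?thesis
          by (rule order_trans) simp
      qed
      then have "sqrt j \<le> 7 / 4 * sqrt i + e"
        by (simp add: real_sqrt_mult)
      then show "6 * (2 * (i - sqrt i)) + 3 / 2 * sqrt i \<le> 6 * (j - sqrt j)"
        by (simp add: j)
    qed (use C in simp)
    ultimately show ?thesis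
      by (simp add: j algebra_simps)
  qed simp
qed

text \<open>
  Division with remainder by a fixed \<open>m\<close> turns the bound on multiples into a bound on the limit
  inferior of \<open>b n / n\<close>; the remainder is controlled by the linear lower bound \<open>lower\<close>. Then \<open>m\<close> tends
  to infinity. The limit may be \<open>\<infinity>\<close>.
\<close>

lemma almost_superadditive_limit:
  fixes b :: "nat \<Rightarrow> real"
  assumes C: "0 \<le> C" and b0: "b 0 = 0"
    and step: "\<And>k l. 1 \<le> l \<Longrightarrow> b k + 2 * b l \<le> b (k + 2 * l) + C * sqrt (real (k + l))"
    and \<delta>: "0 \<le> \<delta>" and lower: "\<And>k l. 1 \<le> k \<Longrightarrow> b k - \<delta> * real l \<le> b (l + k)"
  shows "\<exists>L::ereal. L \<noteq> -\<infinity> \<and> (\<lambda>n. ereal (b n / n)) \<longlonglongrightarrow> L"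
proof -
  define a where "a m = b m / m - 6 * C / sqrt m" for m :: nat
  have le_liminf: "ereal (a m) \<le> liminf (\<lambda>n. ereal (b n / n))" if m: "1 \<le> m" for m
  proof -
    have ev: "a m * (m * real (n div m) / n) - \<delta> * m / n \<le> b n / n" if n: "m \<le> n" for n
    proof -
      let ?j = "n div m"
      have j: "1 \<le> ?j"
        using n m by (simp add: Suc_le_eq div_greater_zero_iff)
      have "m * real ?j * a m = real ?j * b m - 6 * C * sqrt m * ?j"
        using m by (simp add: a_def right_diff_distrib) (simp add: field_simps)
      also have "\<dots> \<le> real ?j * b m - 6 * C * sqrt m * (?j - sqrt ?j)"
        using C by (simp add: right_diff_distrib)
      also have "\<dots> \<le> b (?j * m)"
        using almost_superadditive_multiple[OF C b0 step m j] by simp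
      also have "\<dots> \<le> b n + \<delta> * m"
      proof -
        have "1 \<le> ?j * m"
          using j m by simp
        then have "b (?j * m) - \<delta> * real (n mod m) \<le> b (n mod m + ?j * m)"
          by (rule lower)
        moreover have "\<delta> * real (n mod m) \<le> \<delta> * m"
          using \<delta> m by (intro mult_left_mono) (auto intro: less_imp_le)
        ultimately show ?thesis
          by simp
      qed
      finally have "(m * real ?j * a m - \<delta> * m) / n \<le> b n / n"
        by (intro divide_right_mono) auto
      then show ?thesis
        by (simp add: diff_divide_distrib mult_ac)
    qed
    have "(\<lambda>n. m * real (n div m) / n) \<longlonglongrightarrow> 1"
    proof (rule tendsto_sandwich)
      have "(\<lambda>n. 1 - real m / real n) \<longlonglongrightarrow> 1 - 0"
        by (intro tendsto_diff tendsto_const lim_const_over_n)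
      then show "(\<lambda>n. 1 - real m / real n) \<longlonglongrightarrow> 1"
        by simp
      have split: "real m * real (n div m) + real (n mod m) = n" for n
        by (metis mult_div_mod_eq of_nat_add of_nat_mult)
      have mod_le: "real (n mod m) \<le> m" for n
        using m by (simp add: less_imp_le)
      show "\<forall>\<^sub>F n in sequentially. 1 - real m / real n \<le> m * real (n div m) / n"
        using eventually_gt_at_top[of 0] 
      proof eventually_elim
        case (elim n)
        have "real n \<le> real m * real (n div m) + real m"
          using split[of n] mod_le[of n] by linarith
        then have "(real n - real m) / n \<le> real m * real (n div m) / n"
          by (intro divide_right_mono) auto
        then show ?case
          using elim by (simp add: diff_divide_distrib)
      qed
      show "\<forall>\<^sub>F n in sequentially. m * real (n div m) / n \<le> 1"
        using eventually_gt_at_top[of 0]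
      proof eventually_elim
        case (elim n)
        then show ?case
          using split[of n] by simp
      qed
    qed (rule tendsto_const)
    then have "(\<lambda>n. a m * (m * real (n div m) / n) - \<delta> * m / n) \<longlonglongrightarrow> a m * 1 - 0"
      by (intro tendsto_diff tendsto_mult tendsto_const lim_const_over_n)
    then have "(\<lambda>n. ereal (a m * (m * real (n div m) / n) - \<delta> * m / n)) \<longlonglongrightarrow> ereal (a m)"
      by simp
    then have "ereal (a m) = liminf (\<lambda>n. ereal (a m * (m * real (n div m) / n) - \<delta> * m / n))"
      by (rule lim_imp_Liminf[OF sequentially_bot, symmetric])
    also have "\<dots> \<le> liminf (\<lambda>n. ereal (b n / n))"
      by (rule Liminf_mono, rule eventually_mono[OF eventually_ge_at_top[of m]])
        (simp only: ereal_less_eq ev)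
    finally show ?thesis .
  qed
  have "limsup (\<lambda>n. ereal (b n / n)) \<le> liminf (\<lambda>n. ereal (b n / n))"
  proof (cases "liminf (\<lambda>n. ereal (b n / n))")
    case (real r)
    have "limsup (\<lambda>n. ereal (b n / n)) \<le> limsup (\<lambda>n. ereal (r + 6 * C / sqrt n))"
    proof (rule Limsup_mono, rule eventually_mono[OF eventually_ge_at_top[of 1]])
      fix n :: nat
      assume "1 \<le> n"
      then show "ereal (b n / n) \<le> ereal (r + 6 * C / sqrt n)"
        using le_liminf[of n] real by (simp add: a_def)
    qed
    also have "(\<lambda>n. r + 6 * C / sqrt (real n)) \<longlonglongrightarrow> r + 0"
      by (intro tendsto_add tendsto_const real_tendsto_divide_at_top[OF tendsto_const]
          filterlim_compose[OF sqrt_at_top filterlim_real_sequentially])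
    then have "limsup (\<lambda>n. ereal (r + 6 * C / sqrt n)) = ereal r"
      by (intro lim_imp_Limsup) auto
    finally show ?thesis
      using real by simp
  next
    case MInf
    then show ?thesis
      using le_liminf[of 1] by simp
  qed simp
  then have "limsup (\<lambda>n. ereal (b n / n)) = liminf (\<lambda>n. ereal (b n / n))"
    by (intro antisym Liminf_le_Limsup) auto
  then have "(\<lambda>n. ereal (b n / n)) \<longlonglongrightarrow> liminf (\<lambda>n. ereal (b n / n))"
    by (intro Liminf_eq_Limsup) auto
  moreover have "liminf (\<lambda>n. ereal (b n / n)) \<noteq> -\<infinity>"
    using le_liminf[of 1] by auto
  ultimately show ?thesis
    by blast
qed

text \<open>
  A uniform bound on weighted integrals gives a pointwise bound that is quadratic in \<open>n\<close>: the series of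
  the functions divided by \<open>(n + 1)\<^sup>2\<close> has a finite integral.
\<close>

lemma AE_polynomial_bound:
  fixes r :: "nat \<Rightarrow> 'a \<Rightarrow> real" and p :: "'a \<Rightarrow> real"
  assumes [measurable]: "p \<in> borel_measurable M" "\<And>n. r n \<in> borel_measurable M"
    and p: "AE x in M. 0 < p x" and r: "\<And>n x. 0 \<le> r n x"
    and bound: "\<And>n. (\<integral>\<^sup>+x. ennreal (p x * r n x) \<partial>M) \<le> c" and c: "c < \<infinity>"
  shows "AE x in M. \<exists>G. \<forall>n. r n x \<le> G * (real n + 1)\<^sup>2"
proof -
  define H where "H x = (\<Sum>n. ennreal (p x * r n x) * ennreal (1 / (real n + 1)\<^sup>2))" for x
  have "(\<integral>\<^sup>+x. H x \<partial>M) = (\<Sum>n. (\<integral>\<^sup>+x. ennreal (p x * r n x) \<partial>M) * ennreal (1 / (real n + 1)\<^sup>2))"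
    unfolding H_def by (simp add: nn_integral_suminf nn_integral_multc)
  also have "\<dots> \<le> (\<Sum>n. c * ennreal (1 / (real n + 1)\<^sup>2))"
    using bound by (intro suminf_le mult_right_mono) auto
  also have "\<dots> = c * (\<Sum>n. ennreal (1 / (real n + 1)\<^sup>2))"
    by simp
  also have "\<dots> < \<infinity>"
  proof -
    have "summable (\<lambda>n. 1 / (real n + 1)\<^sup>2)"
      using inverse_squares_sums by (simp add: sums_iff add.commute)
    then have "(\<Sum>n. ennreal (1 / (real n + 1)\<^sup>2)) \<noteq> top"
      by (rule ennreal_suminf_neq_top) simp
    then have "(\<Sum>n. ennreal (1 / (real n + 1)\<^sup>2)) < \<infinity>"
      by (simp only: infinity_ennreal_def less_top)
    then show ?thesis
      using c by (simp add: ennreal_mult_less_top)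
  qed
  finally have "AE x in M. H x \<noteq> \<infinity>"
    by (intro nn_integral_noteq_infinite) (auto simp: H_def)
  then show ?thesis
    using p
  proof eventually_elim
    case (elim x)
    have "r n x \<le> (enn2real (H x) / p x) * (real n + 1)\<^sup>2" for n
    proof -
      have "ennreal (p x * r n x) * ennreal (1 / (real n + 1)\<^sup>2) \<le> H x"
        unfolding H_def by (rule sum_le_suminf[of _ "{n}", simplified]) auto
      then have "ennreal (p x * r n x * (1 / (real n + 1)\<^sup>2)) \<le> H x"
        by (subst ennreal_mult'') simp_all
      also have "H x = ennreal (enn2real (H x))"
        using elim(1) by (simp add: ennreal_enn2real_if)
      finally have "p x * r n x * (1 / (real n + 1)\<^sup>2) \<le> enn2real (H x)"
        by (simp add: ennreal_le_iff)
      then show ?thesis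
        using elim(2) by (simp add: field_simps)
    qed
    then show ?case
      by blast
  qed
qed

lemma root_tendsto_of_log_tendsto:
  fixes w :: "nat \<Rightarrow> real"
  assumes w: "\<And>k. 0 < w k" and L: "(\<lambda>n. ereal (ln (w n) / n)) \<longlonglongrightarrow> L" "L \<noteq> -\<infinity>"
  shows "\<exists>g. 0 < g \<and> (\<lambda>k. ennroot k (ennreal (w k))) \<longlonglongrightarrow> g"
proof -
  have root: "\<forall>\<^sub>F n in sequentially. ennreal (exp (ln (w n) / n)) = ennroot n (ennreal (w n))"
    using eventually_ge_at_top[of 1]
  proof eventually_elim
    case (elim n)
    then have "root n (w n) = exp (ln (w n) / n)"
      using w[of n] by (simp add: root_powr_inverse powr_def)
    then show ?case
      using w[of n] by (simp add: ennroot_def)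
  qed
  show ?thesis
  proof (cases L)
    case (real r)
    then have "(\<lambda>n. ennreal (exp (ln (w n) / n))) \<longlonglongrightarrow> ennreal (exp r)"
      using L by (intro tendsto_ennrealI tendsto_exp) simp
    then show ?thesis
      using tendsto_cong[OF root] by (intro exI[of _ "ennreal (exp r)"]) simp
  next
    case PInf
    then have "filterlim (\<lambda>n. ln (w n) / n) at_top sequentially"
      using L by (simp add: tendsto_PInfty_eq_at_top)
    then have "(\<lambda>n. ennreal (exp (ln (w n) / n))) \<longlonglongrightarrow> top"
      unfolding ennreal_tendsto_top_eq_at_top by (rule filterlim_compose[OF exp_at_top])
    then show ?thesis
      using tendsto_cong[OF root] by (intro exI[of _ top]) simp
  qed (use L in simp)
qed

lemma ennroot_ennreal: "0 \<le> a \<Longrightarrow> ennroot k (ennreal a) = ennreal (root k a)"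
  by (simp add: ennroot_def)

lemma ennroot_mono: "1 \<le> k \<Longrightarrow> a \<le> b \<Longrightarrow> ennroot k a \<le> ennroot k b"
  by (cases a; cases b) (auto simp: ennroot_def ennreal_leI top_unique)

lemma root_const_tendsto_ennreal:
  assumes "0 < c"
  shows "(\<lambda>k. ennreal (s * root k c)) \<longlonglongrightarrow> ennreal s"
  using tendsto_mult[OF tendsto_const[of s] LIMSEQ_root_const[OF assms]]
  by (intro tendsto_ennrealI) simp

lemma borel_measurable_completion_AE_eq:
  fixes g h :: "'a \<Rightarrow> 'b :: topological_space"
  assumes eq: "AE x in M. g x = h x" and h: "h \<in> borel_measurable M"
  shows "g \<in> borel_measurable (completion M)"
proof (rule measurableI)
  fix A :: "'b set"
  assume A: "A \<in> sets borel"
  obtain N where N: "{x \<in> space M. g x \<noteq> h x} \<subseteq> N" "N \<in> sets M" "emeasure M N = 0"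
    using eq by (auto elim: AE_E)
  have "g -` A \<inter> space M = (h -` A \<inter> space M - N) \<union> (g -` A \<inter> space M \<inter> N)"
    using N(1) by auto
  moreover have "h -` A \<inter> space M - N \<in> sets M"
    using measurable_sets[OF h A] N(2) by blast
  ultimately show "g -` A \<inter> space (completion M) \<in> sets (completion M)"
    using N by (intro sets_completionI[of _ "h -` A \<inter> space M - N" "g -` A \<inter> space M \<inter> N" N]) auto
qed simp

lemma tendsto_power_ennreal:
  fixes X :: "nat \<Rightarrow> ennreal"
  assumes X: "X \<longlonglongrightarrow> g" and "0 < g"
  shows "(\<lambda>n. X n ^ k) \<longlonglongrightarrow> g ^ k"
proof (induction k)
  case (Suc k)
  have "g ^ k \<noteq> 0"
    using assms(2) by simp
  then show ?case
    using assms(2) by (auto intro!: tendsto_mult_ennreal X Suc)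
qed simp

section \<open>The main inequality\<close>

text \<open>
  The Cauchy--Schwarz inequality in the form \<open>A\<^sup>2 \<le> (\<Sum> p / w) * (\<Sum> p * w)\<close> for \<open>A = \<Sum> p\<close>, obtained by
  summing \<open>2 * p \<le> p * (t / w + w / t)\<close> for the optimal value of \<open>t\<close>.
\<close>

lemma sum_reciprocal_ge:
  fixes p :: "'a \<Rightarrow> ennreal" and w :: "'a \<Rightarrow> real"
  assumes w: "\<And>y. 0 < w y" and A: "(\<integral>\<^sup>+y. p y \<partial>count_space S) = ennreal A" "0 < A"
    and V: "(\<integral>\<^sup>+y. p y * ennreal (w y) \<partial>count_space S) \<le> ennreal V" "0 < V"
  shows "ennreal (A\<^sup>2 / V) \<le> (\<integral>\<^sup>+y. p y * ennreal (1 / w y) \<partial>count_space S)"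
proof -
  define t where "t = V / A"
  have t: "0 < t"
    using A V by (simp add: t_def)
  have two: "2 \<le> t / w y + w y / t" for y
  proof -
    have "0 \<le> (t - w y)\<^sup>2 / (t * w y)"
      using t w[of y] by simp
    also have "\<dots> = t / w y + w y / t - 2"
      using t w[of y] by (simp add: field_simps power2_eq_square)
    finally show ?thesis
      by simp
  qed
  have "p y * 2 \<le> ennreal t * (p y * ennreal (1 / w y)) + ennreal (1 / t) * (p y * ennreal (w y))" for y
  proof -
    have "p y * 2 \<le> p y * ennreal (t / w y + w y / t)"
      using two[of y] by (intro mult_left_mono) (auto simp flip: ennreal_numeral)
    also have "ennreal (t / w y + w y / t) = ennreal t * ennreal (1 / w y) + ennreal (1 / t) * ennreal (w y)"
      using t w[of y] by (simp add: less_imp_le flip: ennreal_mult' ennreal_plus)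
    finally show ?thesis
      by (simp add: algebra_simps)
  qed
  then have "(\<integral>\<^sup>+y. p y * 2 \<partial>count_space S) \<le>
      (\<integral>\<^sup>+y. ennreal t * (p y * ennreal (1 / w y)) + ennreal (1 / t) * (p y * ennreal (w y)) \<partial>count_space S)"
    by (intro nn_integral_mono)
  then have le: "ennreal A * 2 \<le> ennreal t * (\<integral>\<^sup>+y. p y * ennreal (1 / w y) \<partial>count_space S) +
      ennreal (1 / t) * (\<integral>\<^sup>+y. p y * ennreal (w y) \<partial>count_space S)"
    by (simp add: nn_integral_add nn_integral_cmult nn_integral_multc A)
  also have "\<dots> \<le> ennreal t * (\<integral>\<^sup>+y. p y * ennreal (1 / w y) \<partial>count_space S) + ennreal A"
  proof -
    have "ennreal (1 / t) * (\<integral>\<^sup>+y. p y * ennreal (w y) \<partial>count_space S) \<le> ennreal (1 / t) * ennreal V"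
      using V by (intro mult_left_mono) auto
    also have "\<dots> = ennreal A"
      using A V t by (simp add: t_def flip: ennreal_mult')
    finally show ?thesis
      by (intro add_left_mono)
  qed
  finally have main: "ennreal A * 2 \<le>
      ennreal t * (\<integral>\<^sup>+y. p y * ennreal (1 / w y) \<partial>count_space S) + ennreal A" .
  show ?thesis
  proof (cases "\<integral>\<^sup>+y. p y * ennreal (1 / w y) \<partial>count_space S" rule: ennreal_cases)
    case (real q)
    have "ennreal (A * 2) \<le> ennreal (t * q + A)"
      using main real t A by (simp add: ennreal_mult' ennreal_plus)
    then have "A \<le> t * q"
      using t real A by (subst (asm) ennreal_le_iff) auto
    then have "A\<^sup>2 / V \<le> q"
      using A V by (simp add: t_def field_simps power2_eq_square)
    then show ?thesis
      using real by (simp add: ennreal_leI)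
  qed simp
qed

text \<open>
  A sequence of kernels, reversible with respect to \<open>\<pi>\<close> and supermultiplicative under convolution,
  whose class sums are positive, finite and grow at least geometrically.
\<close>

locale growth_family = pmp_relation +
  fixes \<pi> :: "'a \<Rightarrow> real" and f :: "nat \<Rightarrow> 'a \<times> 'a \<Rightarrow> ennreal"
  assumes \<pi>_integrable: "integrable M \<pi>"
    and \<pi>_pos: "AE x in M. 0 < \<pi> x"
    and f_measurable: "\<And>k. 1 \<le> k \<Longrightarrow> f k \<in> borel_measurable (rel_measure M R)"
    and f_reversible: "\<And>k. 1 \<le> k \<Longrightarrow>
      AE (x, y) in rel_measure M R. ennreal (\<pi> x) * f k (x, y) = ennreal (\<pi> y) * f k (y, x)"
    and f_convolution: "\<And>l k. 1 \<le> l \<Longrightarrow> 1 \<le> k \<Longrightarrow>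
      AE x in M. (\<Sum>\<^sub>\<infinity>(y, z)\<in>R `` {x} \<times> R `` {x}. f l (x, z) * f k (z, y))
        \<le> class_sum R (f (l + k)) x"
    and class_sum_finite: "AE x in M. \<forall>k\<ge>1. 0 < class_sum R (f k) x \<and> class_sum R (f k) x < \<infinity>"
    and class_sum_growth: "\<exists>D :: 'a \<Rightarrow> real. D \<in> borel_measurable M \<and> (\<forall>x\<in>space M. 0 < D x) \<and>
      (AE x in M. \<forall>l\<ge>1. \<forall>k\<ge>1.
        class_sum R (f (l + k)) x \<ge> ennreal (D x) ^ l * class_sum R (f k) x)"
begin

lemma \<pi>_measurable [measurable]: "\<pi> \<in> borel_measurable M"
  using \<pi>_integrable by (rule borel_measurable_integrable)

text \<open>
  Borel versions, positive and finite everywhere, of the class sums of the kernels. The index \<open>0\<close>, at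
  which no kernel is given, gets the value \<open>1\<close>, as if \<open>f 0\<close> were the identity kernel; this makes the
  inequalities below hold for \<open>k = 0\<close>.
\<close>

definition weight :: "nat \<Rightarrow> 'a \<Rightarrow> real" where
  "weight = (SOME F. F 0 = (\<lambda>_. 1) \<and> (\<forall>k. F k \<in> borel_measurable M \<and> (\<forall>x. 0 < F k x)) \<and>
    (\<forall>k\<ge>1. AE x in M. class_sum R (f k) x = ennreal (F k x)))"

lemma weight_spec:
  "weight 0 = (\<lambda>_. 1) \<and> (\<forall>k. weight k \<in> borel_measurable M \<and> (\<forall>x. 0 < weight k x)) \<and>
    (\<forall>k\<ge>1. AE x in M. class_sum R (f k) x = ennreal (weight k x))"
proof -
  have "\<exists>h. h \<in> borel_measurable M \<and> (\<forall>x. 0 < h x) \<and>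
      (AE x in M. class_sum R (f k) x = ennreal (h x))" if k: "1 \<le> k" for k
  proof -
    obtain g where g[measurable]: "g \<in> borel_measurable M" and eq: "AE x in M. orbit_sum (f k) x = g x"
      using completion_ex_borel_measurable[OF orbit_sum_measurable[OF f_measurable[OF k]]] by blast
    define h where "h x = (if 0 < g x \<and> g x < \<infinity> then enn2real (g x) else 1)" for x
    have "h \<in> borel_measurable M"
      unfolding h_def by measurable
    moreover have "0 < h x" for x
      by (auto simp: h_def enn2real_positive_iff)
    moreover have "AE x in M. class_sum R (f k) x = ennreal (h x)"
      using eq AE_class_sum class_sum_finite
      by eventually_elim (use k in \<open>auto simp: h_def\<close>)
    ultimately show ?thesis
      by blast
  qed
  then obtain F where F: "\<And>k. 1 \<le> k \<Longrightarrow> F k \<in> borel_measurable M \<and> (\<forall>x. 0 < F k x) \<and>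
      (AE x in M. class_sum R (f k) x = ennreal (F k x))"
    by metis
  define F' where "F' k = (if k = 0 then \<lambda>_. 1 else F k)" for k
  have "\<exists>F. F 0 = (\<lambda>_. 1) \<and> (\<forall>k. F k \<in> borel_measurable M \<and> (\<forall>x. 0 < F k x)) \<and>
      (\<forall>k\<ge>1. AE x in M. class_sum R (f k) x = ennreal (F k x))"
    using F by (intro exI[of _ F']) (auto simp: F'_def)
  then show ?thesis
    unfolding weight_def by (rule someI_ex)
qed

lemma weight_0 [simp]: "weight 0 x = 1"
  and weight_measurable [measurable]: "weight k \<in> borel_measurable M"
  and weight_pos: "0 < weight k x"
  and weight_nonneg [simp]: "0 \<le> weight k x"
  using weight_spec by (auto intro: less_imp_le)

lemma AE_class_sum_eq_weight: "AE x in M. \<forall>k\<ge>1. class_sum R (f k) x = ennreal (weight k x)"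
  using weight_spec by (simp add: AE_all_countable)

lemma AE_orbit_sum_eq_weight: "AE x in M. \<forall>k\<ge>1. orbit_sum (f k) x = ennreal (weight k x)"
  using AE_class_sum_eq_weight AE_class_sum by eventually_elim simp

lemma AE_convolution_le:
  assumes "1 \<le> l"
  shows "AE x in M. orbit_sum (\<lambda>(x, z). f l (x, z) * ennreal (weight k z)) x \<le> ennreal (weight (l + k) x)"
proof (cases "k = 0")
  case True
  show ?thesis
    using AE_orbit_sum_eq_weight
    by eventually_elim (use assms True in \<open>simp add: orbit_sum_def\<close>)
next
  case False
  then have k: "1 \<le> k"
    by simp
  show ?thesis
    using f_convolution[OF assms k] AE_countable_class AE_saturate[OF AE_orbit_sum_eq_weight]
      AE_class_sum_eq_weight
  proof eventually_elim
    case (elim x)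
    let ?A = "R `` {x}"
    let ?g = "\<lambda>(y, z). f l (x, z) * f k (z, y)"
    have "(\<Sum>\<^sub>\<infinity>p\<in>?A \<times> ?A. ?g p) = (\<integral>\<^sup>+p. ?g p \<partial>count_space (?A \<times> ?A))"
      using elim(2) by (intro infsum_ennreal_eq_nn_integral) simp
    also have "\<dots> = (\<integral>\<^sup>+p. ?g p * indicator (?A \<times> ?A) p \<partial>count_space UNIV)"
      by (simp add: nn_integral_count_space_indicator)
    also have "\<dots> = (\<integral>\<^sup>+z. \<integral>\<^sup>+y. ?g (y, z) * indicator (?A \<times> ?A) (y, z) \<partial>count_space UNIV \<partial>count_space UNIV)"
      by (rule nn_integral_snd_count_space[symmetric])
    also have "\<dots> = (\<integral>\<^sup>+z. (\<integral>\<^sup>+y. f l (x, z) * f k (z, y) \<partial>count_space ?A) * indicator ?A z \<partial>count_space UNIV)"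
      by (intro nn_integral_cong)
        (auto simp: nn_integral_count_space_indicator split: split_indicator intro!: nn_integral_cong)
    also have "\<dots> = (\<integral>\<^sup>+z. (\<integral>\<^sup>+y. f l (x, z) * f k (z, y) \<partial>count_space ?A) \<partial>count_space ?A)"
      by (simp add: nn_integral_count_space_indicator)
    also have "\<dots> = (\<integral>\<^sup>+z. f l (x, z) * ennreal (weight k z) \<partial>count_space ?A)"
    proof (rule nn_integral_cong)
      fix z
      assume "z \<in> space (count_space ?A)"
      then have z: "(x, z) \<in> R"
        by simp
      have "(\<integral>\<^sup>+y. f l (x, z) * f k (z, y) \<partial>count_space ?A) = f l (x, z) * orbit_sum (f k) z"
        using class_eq[OF z] by (simp add: nn_integral_cmult orbit_sum_def)
      then show "(\<integral>\<^sup>+y. f l (x, z) * f k (z, y) \<partial>count_space ?A) = f l (x, z) * ennreal (weight k z)"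
        using elim(3) z k by simp
    qed
    finally show ?case
      using elim(1,4) assms by (simp add: orbit_sum_def)
  qed
qed

text \<open>
  The main inequality. By Cauchy--Schwarz and supermultiplicativity, the integrand is at most the class
  sum over \<open>y\<close> of \<open>G (x, y) = \<pi> x * f l (x, y) * weight k x / weight (l + k) y\<close>. Mass transport
  replaces \<open>G (x, y)\<close> by \<open>G (y, x)\<close>, which by reversibility is
  \<open>\<pi> x * f l (x, y) * weight k y / weight (l + k) x\<close>, and by supermultiplicativity again the class sum
  of that is at most \<open>\<pi> x\<close>.
\<close>

lemma nn_integral_weight_ratio:
  assumes l: "1 \<le> l"
  shows "(\<integral>\<^sup>+x. ennreal (\<pi> x * (weight k x * (weight l x)\<^sup>2 / weight (k + 2 * l) x)) \<partial>M)
    \<le> (\<integral>\<^sup>+x. ennreal (\<pi> x) \<partial>M)"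
proof -
  define G where "G = (\<lambda>(x, y). ennreal (\<pi> x) * f l (x, y) * ennreal (weight k x / weight (l + k) y))"
  note [measurable] = f_measurable[OF l] borel_measurable_fst_rel borel_measurable_snd_rel
  have G_meas: "G \<in> borel_measurable (rel_measure M R)"
    unfolding G_def case_prod_unfold by (simp, measurable)
  have "(\<integral>\<^sup>+x. ennreal (\<pi> x * (weight k x * (weight l x)\<^sup>2 / weight (k + 2 * l) x)) \<partial>M) \<le>
      (\<integral>\<^sup>+x. orbit_sum G x \<partial>M)"
  proof (rule nn_integral_mono_AE)
    show "AE x in M. ennreal (\<pi> x * (weight k x * (weight l x)\<^sup>2 / weight (k + 2 * l) x)) \<le> orbit_sum G x"
      using \<pi>_pos AE_orbit_sum_eq_weight AE_convolution_le[OF l, of "l + k"]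
    proof eventually_elim
      case (elim x)
      let ?Q = "\<integral>\<^sup>+y. f l (x, y) * ennreal (1 / weight (l + k) y) \<partial>count_space (R `` {x})"
      have "ennreal ((weight l x)\<^sup>2 / weight (l + (l + k)) x) \<le> ?Q"
        using elim(2,3) l weight_pos by (intro sum_reciprocal_ge) (simp_all add: orbit_sum_def)
      moreover have "orbit_sum G x = ennreal (\<pi> x * weight k x) * ?Q"
      proof -
        have "orbit_sum G x = (\<integral>\<^sup>+y. ennreal (\<pi> x * weight k x) *
            (f l (x, y) * ennreal (1 / weight (l + k) y)) \<partial>count_space (R `` {x}))"
          unfolding orbit_sum_def G_def
          using elim(1) by (intro nn_integral_cong)
            (simp add: ennreal_mult' divide_inverse mult_ac)
        then show ?thesis
          by (simp add: nn_integral_cmult)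
      qed
      moreover have "ennreal (\<pi> x * (weight k x * (weight l x)\<^sup>2 / weight (k + 2 * l) x)) =
          ennreal (\<pi> x * weight k x) * ennreal ((weight l x)\<^sup>2 / weight (l + (l + k)) x)"
        using elim(1) by (simp add: ennreal_mult'[symmetric] mult_2 add_ac)
      ultimately show ?case
        by (simp add: mult_left_mono)
    qed
  qed
  also have "\<dots> = (\<integral>\<^sup>+x. orbit_sum (\<lambda>(x, y). G (y, x)) x \<partial>M)"
    using G_meas by (rule mass_transport)
  also have "\<dots> \<le> (\<integral>\<^sup>+x. ennreal (\<pi> x) \<partial>M)"
  proof (rule nn_integral_mono_AE)
    show "AE x in M. orbit_sum (\<lambda>(x, y). G (y, x)) x \<le> ennreal (\<pi> x)"
      using AE_rel_imp_AE_class[OF f_reversible[OF l]] AE_convolution_le[OF l, of k]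
    proof eventually_elim
      case (elim x)
      have "orbit_sum (\<lambda>(x, y). G (y, x)) x =
          (\<integral>\<^sup>+y. (ennreal (\<pi> x) * ennreal (1 / weight (l + k) x)) *
            (f l (x, y) * ennreal (weight k y)) \<partial>count_space (R `` {x}))"
        unfolding orbit_sum_def
      proof (rule nn_integral_cong)
        fix y
        assume "y \<in> space (count_space (R `` {x}))"
        then have "ennreal (\<pi> y) * f l (y, x) = ennreal (\<pi> x) * f l (x, y)"
          using elim(1) by auto
        then have "G (y, x) = (ennreal (\<pi> x) * f l (x, y)) * ennreal (weight k y / weight (l + k) x)"
          by (simp add: G_def)
        then show "(case (x, y) of (x, y) \<Rightarrow> G (y, x)) =
            (ennreal (\<pi> x) * ennreal (1 / weight (l + k) x)) * (f l (x, y) * ennreal (weight k y))"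
          by (simp add: divide_inverse ennreal_mult' mult_ac)
      qed
      also have "\<dots> = (ennreal (\<pi> x) * ennreal (1 / weight (l + k) x)) *
          orbit_sum (\<lambda>(x, y). f l (x, y) * ennreal (weight k y)) x"
        by (simp add: nn_integral_cmult orbit_sum_def)
      also have "\<dots> \<le> (ennreal (\<pi> x) * ennreal (1 / weight (l + k) x)) * ennreal (weight (l + k) x)"
        using elim(2) by (intro mult_left_mono) auto
      also have "\<dots> = ennreal (\<pi> x)"
        using weight_pos[of "l + k" x] by (simp add: mult.assoc flip: ennreal_mult')
      finally show ?case .
    qed
  qed
  finally show ?thesis .
qed

section \<open>Existence of the growth rate\<close>

lemma \<pi>_integral_finite: "(\<integral>\<^sup>+x. ennreal (\<pi> x) \<partial>M) < \<infinity>"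
proof -
  have "(\<integral>\<^sup>+x. ennreal (\<pi> x) \<partial>M) \<le> (\<integral>\<^sup>+x. ennreal (norm (\<pi> x)) \<partial>M)"
    by (intro nn_integral_mono ennreal_leI) simp
  also have "\<dots> < \<infinity>"
    using \<pi>_integrable by (simp add: integrable_iff_bounded)
  finally show ?thesis .
qed

text \<open>
  All the ratios of \<open>nn_integral_weight_ratio\<close> are controlled at once by enumerating the pairs
  \<open>(k, l)\<close>; a polynomial bound in the code of the pair is a logarithmic error after taking
  logarithms, which the square root absorbs.
\<close>

lemma AE_log_weight_superadditive:
  "AE x in M. \<exists>C\<ge>0. \<forall>k l. 1 \<le> l \<longrightarrow>
    ln (weight k x) + 2 * ln (weight l x) \<le> ln (weight (k + 2 * l) x) + C * sqrt (real (k + l))"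
proof -
  define r where "r n x = (case prod_decode n of (k, l) \<Rightarrow>
      if 1 \<le> l then weight k x * (weight l x)\<^sup>2 / weight (k + 2 * l) x else 0)" for n x
  have [measurable]: "r n \<in> borel_measurable M" for n
    unfolding r_def by (cases "prod_decode n") simp
  have "(\<integral>\<^sup>+x. ennreal (\<pi> x * r n x) \<partial>M) \<le> (\<integral>\<^sup>+x. ennreal (\<pi> x) \<partial>M)" for n
  proof (cases "prod_decode n")
    case (Pair k l)
    then show ?thesis
      using nn_integral_weight_ratio[of l k] by (cases "1 \<le> l") (auto simp: r_def)
  qed
  moreover note \<pi>_integral_finite
  moreover have "0 \<le> r n x" for n x
    by (auto simp: r_def split: prod.splits)
  ultimately have "AE x in M. \<exists>G. \<forall>n. r n x \<le> G * (real n + 1)\<^sup>2"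
    using \<pi>_pos by (intro AE_polynomial_bound[of \<pi> M r]) auto
  then show ?thesis
  proof eventually_elim
    case (elim x)
    then obtain G where G: "\<And>n. r n x \<le> G * (real n + 1)\<^sup>2"
      by blast
    have "ln (weight k x) + 2 * ln (weight l x) \<le>
        ln (weight (k + 2 * l) x) + (\<bar>ln G\<bar> + 8) * sqrt (real (k + l))" if l: "1 \<le> l" for k l
    proof -
      let ?q = "weight k x * (weight l x)\<^sup>2 / weight (k + 2 * l) x" and ?s = "real (k + l)"
      have q_pos: "0 < ?q"
        by (intro divide_pos_pos mult_pos_pos zero_less_power weight_pos)
      have q_le: "?q \<le> G * (real (prod_encode (k, l)) + 1)\<^sup>2"
        using G[of "prod_encode (k, l)"] l by (simp add: r_def)
      have G_pos: "0 < G"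
        using less_le_trans[OF q_pos q_le] by (simp add: zero_less_mult_iff)
      have "prod_encode (k, l) + 1 \<le> (k + l + 1)\<^sup>2"
      proof -
        have "triangle (k + l) \<le> (k + l) * Suc (k + l)"
          by (simp add: triangle_def)
        then show ?thesis
          by (simp add: prod_encode_def power2_eq_square algebra_simps)
      qed
      then have "real (prod_encode (k, l) + 1) \<le> real ((k + l + 1)\<^sup>2)"
        by (simp only: of_nat_le_iff)
      then have "real (prod_encode (k, l)) + 1 \<le> (?s + 1)\<^sup>2"
        by (simp add: add_ac)
      then have "(real (prod_encode (k, l)) + 1)\<^sup>2 \<le> ((?s + 1)\<^sup>2)\<^sup>2"
        by (intro power_mono) auto
      then have "?q \<le> G * ((?s + 1)\<^sup>2)\<^sup>2"
        using q_le G_pos by (meson mult_left_mono less_imp_le order_trans)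
      then have "ln ?q \<le> ln (G * ((?s + 1)\<^sup>2)\<^sup>2)"
        using q_pos by (simp only: ln_mono)
      also have "\<dots> = ln G + 4 * ln (?s + 1)"
        using G_pos by (simp add: ln_mult ln_realpow)
      also have "ln (?s + 1) \<le> 2 * sqrt ?s"
      proof -
        have "ln (?s + 1) = 2 * ln (sqrt (?s + 1))"
          by (simp add: ln_sqrt)
        also have "ln (sqrt (?s + 1)) \<le> sqrt (?s + 1) - 1"
          by (rule ln_le_minus_one) simp
        also have "sqrt (?s + 1) \<le> sqrt ?s + sqrt 1"
          by (rule sqrt_add_le_add_sqrt) auto
        finally show ?thesis
          by simp
      qed
      also have "ln G \<le> \<bar>ln G\<bar> * sqrt ?s"
      proof -
        have "\<bar>ln G\<bar> * 1 \<le> \<bar>ln G\<bar> * sqrt ?s"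
          using l by (intro mult_left_mono) auto
        then show ?thesis
          by simp
      qed
      finally have "ln ?q \<le> (\<bar>ln G\<bar> + 8) * sqrt ?s"
        by (simp add: algebra_simps)
      moreover have "ln ?q = ln (weight k x) + 2 * ln (weight l x) - ln (weight (k + 2 * l) x)"
        using weight_pos[of k x] weight_pos[of l x] weight_pos[of "k + 2 * l" x]
        by (simp add: ln_div ln_mult ln_realpow)
      ultimately show ?thesis
        by simp
    qed
    then show ?case
      by (intro exI[of _ "\<bar>ln G\<bar> + 8"]) auto
  qed
qed

lemma AE_log_weight_lower:
  "AE x in M. \<exists>\<delta>\<ge>0. \<forall>k l. 1 \<le> k \<longrightarrow> ln (weight k x) - \<delta> * real l \<le> ln (weight (l + k) x)"
proof -
  obtain D :: "'a \<Rightarrow> real" where D: "\<And>x. x \<in> space M \<Longrightarrow> 0 < D x"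
      "AE x in M. \<forall>l\<ge>1. \<forall>k\<ge>1. class_sum R (f (l + k)) x \<ge> ennreal (D x) ^ l * class_sum R (f k) x"
    using class_sum_growth by blast
  show ?thesis
    using D(2) AE_class_sum_eq_weight AE_space
  proof eventually_elim
    case (elim x)
    have Dx: "0 < D x"
      using D(1) elim(3) by simp
    have "ln (weight k x) - \<bar>ln (D x)\<bar> * real l \<le> ln (weight (l + k) x)" if k: "1 \<le> k" for k l
    proof (cases "l = 0")
      case False
      then have l: "1 \<le> l"
        by simp
      have "ennreal (D x) ^ l * ennreal (weight k x) \<le> ennreal (weight (l + k) x)"
        using elim(1)[rule_format, OF l k] elim(2)[rule_format, OF k]
          elim(2)[rule_format, of "l + k"] l by simp
      then have "ennreal (D x ^ l * weight k x) \<le> ennreal (weight (l + k) x)"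
        using Dx by (simp add: ennreal_mult' ennreal_power)
      then have "D x ^ l * weight k x \<le> weight (l + k) x"
        by (simp add: ennreal_le_iff)
      moreover have "0 < D x ^ l * weight k x"
        using Dx weight_pos by simp
      ultimately have "ln (D x ^ l * weight k x) \<le> ln (weight (l + k) x)"
        by (simp only: ln_mono)
      moreover have "ln (D x ^ l * weight k x) = real l * ln (D x) + ln (weight k x)"
        using Dx weight_pos[of k x] by (simp add: ln_mult ln_realpow)
      moreover have "- (\<bar>ln (D x)\<bar> * real l) \<le> real l * ln (D x)"
      proof -
        have "real l * - \<bar>ln (D x)\<bar> \<le> real l * ln (D x)"
          by (intro mult_left_mono) auto
        then show ?thesis
          by (simp add: mult.commute)
      qed
      ultimately show ?thesis
        by simp
    qed simp
    then show ?case
      by (intro exI[of _ "\<bar>ln (D x)\<bar>"]) auto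
  qed
qed

lemma root_weight_measurable [measurable]: "(\<lambda>x. root k (weight j x)) \<in> borel_measurable M"
proof -
  have "root k \<in> borel_measurable borel"
    by (intro borel_measurable_continuous_onI continuous_on_real_root continuous_on_id)
  then show ?thesis
    by (rule measurable_compose[OF weight_measurable])
qed

text \<open>A Borel version of \<^const>\<open>growth_rate\<close>.\<close>

definition rate :: "'a \<Rightarrow> ennreal" where
  "rate x = lim (\<lambda>k. ennreal (root k (weight k x)))"

lemma rate_measurable [measurable]: "rate \<in> borel_measurable M"
  unfolding rate_def[abs_def] by measurable

lemma AE_rate: "AE x in M. 0 < rate x \<and> (\<lambda>k. ennreal (root k (weight k x))) \<longlonglongrightarrow> rate x"
  using AE_log_weight_superadditive AE_log_weight_lower
proof eventually_elim
  case (elim x)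
  then obtain C \<delta> where C: "0 \<le> C" "\<And>k l. 1 \<le> l \<Longrightarrow>
      ln (weight k x) + 2 * ln (weight l x) \<le> ln (weight (k + 2 * l) x) + C * sqrt (real (k + l))"
    and \<delta>: "0 \<le> \<delta>" "\<And>k l. 1 \<le> k \<Longrightarrow> ln (weight k x) - \<delta> * real l \<le> ln (weight (l + k) x)"
    by blast
  obtain L :: ereal where L: "L \<noteq> -\<infinity>" "(\<lambda>n. ereal (ln (weight n x) / n)) \<longlonglongrightarrow> L"
    using almost_superadditive_limit[of C "\<lambda>n. ln (weight n x)" \<delta>] C \<delta> by auto
  obtain g where g: "0 < g" "(\<lambda>k. ennroot k (ennreal (weight k x))) \<longlonglongrightarrow> g"
    using root_tendsto_of_log_tendsto[OF weight_pos L(2,1)] by blast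
  have "(\<lambda>k. ennreal (root k (weight k x))) \<longlonglongrightarrow> g"
    using g(2) by (simp add: ennroot_ennreal)
  then show ?case
    using g(1) limI by (metis rate_def)
qed

lemma AE_growth_rate:
  "AE x in M. convergent (\<lambda>k. ennroot k (class_sum R (f k) x)) \<and> growth_rate R f x = rate x"
  using AE_rate AE_class_sum_eq_weight
proof eventually_elim
  case (elim x)
  have "\<forall>\<^sub>F k in sequentially. ennreal (root k (weight k x)) = ennroot k (class_sum R (f k) x)"
    using eventually_ge_at_top[of 1]
    by eventually_elim (use elim(2) in \<open>simp add: ennroot_ennreal\<close>)
  then have "(\<lambda>k. ennroot k (class_sum R (f k) x)) \<longlonglongrightarrow> rate x"
    by (rule Lim_transform_eventually[OF conjunct2[OF elim(1)]])
  then show ?case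
    unfolding growth_rate_def by (simp add: convergentI limI)
qed

section \<open>The integral bound\<close>

text \<open>
  With \<open>F = weight\<close> and apart from the factor \<open>\<pi>\<close>, the integrand
  \<open>F l / root (2 ^ Suc N) (F (2 ^ Suc N * l))\<close> is the geometric mean of \<open>(F l)\<^sup>2 / F (2 * l)\<close> and of
  the integrand of stage \<open>N\<close> at \<open>2 * l\<close>. The first of these is
  covered by \<open>nn_integral_weight_ratio\<close> with \<open>k = 0\<close>, the second by induction.
\<close>

lemma nn_integral_weight_div_root:
  assumes "1 \<le> l"
  shows "(\<integral>\<^sup>+x. ennreal (\<pi> x * (weight l x / root (2 ^ N) (weight (2 ^ N * l) x))) \<partial>M)
    \<le> (\<integral>\<^sup>+x. ennreal (\<pi> x) \<partial>M)"
  using assms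
proof (induction N arbitrary: l)
  case 0
  have "weight l x / weight l x = 1" for x
    using weight_pos[of l x] by simp
  then show ?case
    by simp
next
  case (Suc N)
  define A where "A x = (weight l x)\<^sup>2 / weight (2 * l) x" for x
  define B where "B x = weight (2 * l) x / root (2 ^ N) (weight (2 ^ N * (2 * l)) x)" for x
  have B_meas [measurable]: "B \<in> borel_measurable M"
    unfolding B_def by measurable
  have A_meas [measurable]: "A \<in> borel_measurable M"
    unfolding A_def by measurable
  have AB: "0 < A x" "0 < B x" for x
    by (auto simp: A_def B_def intro!: divide_pos_pos zero_less_power real_root_gt_zero weight_pos)
  have "weight l x / root (2 ^ Suc N) (weight (2 ^ Suc N * l) x) \<le> (A x + B x) / 2" for x
  proof -
    let ?W = "weight (2 ^ N * (2 * l)) x"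
    have "A x * B x = (weight l x)\<^sup>2 / root (2 ^ N) ?W"
      using weight_pos[of "2 * l" x] by (simp add: A_def B_def)
    then have "sqrt (A x * B x) = weight l x / sqrt (root (2 ^ N) ?W)"
      by (simp add: real_sqrt_divide)
    also have "sqrt (root (2 ^ N) ?W) = root (2 ^ Suc N) (weight (2 ^ Suc N * l) x)"
      by (simp add: sqrt_def real_root_mult_exp mult_ac)
    finally show ?thesis
      using arith_geo_mean_sqrt[of "A x" "B x"] AB[of x] by simp
  qed
  then have "(\<integral>\<^sup>+x. ennreal (\<pi> x * (weight l x / root (2 ^ Suc N) (weight (2 ^ Suc N * l) x))) \<partial>M)
      \<le> (\<integral>\<^sup>+x. ennreal (1 / 2) * (ennreal (\<pi> x * A x) + ennreal (\<pi> x * B x)) \<partial>M)"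
  proof (intro nn_integral_mono_AE)
    show "AE x in M. ennreal (\<pi> x * (weight l x / root (2 ^ Suc N) (weight (2 ^ Suc N * l) x)))
        \<le> ennreal (1 / 2) * (ennreal (\<pi> x * A x) + ennreal (\<pi> x * B x))"
      using \<pi>_pos
    proof eventually_elim
      case (elim x)
      let ?u = "weight l x / root (2 ^ Suc N) (weight (2 ^ Suc N * l) x)"
      have "\<pi> x * ?u \<le> \<pi> x * ((A x + B x) / 2)"
        using \<open>?u \<le> (A x + B x) / 2\<close> elim by (intro mult_left_mono) auto
      also have "\<dots> = 1 / 2 * (\<pi> x * A x + \<pi> x * B x)"
        by (simp add: algebra_simps)
      finally have "ennreal (\<pi> x * ?u) \<le> ennreal (1 / 2 * (\<pi> x * A x + \<pi> x * B x))"
        by (rule ennreal_leI)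
      also have "\<dots> = ennreal (1 / 2) * (ennreal (\<pi> x * A x) + ennreal (\<pi> x * B x))"
        using elim AB[of x] by (subst ennreal_mult) (auto simp: less_imp_le)
      finally show ?case .
    qed
  qed
  also have "\<dots> = ennreal (1 / 2) *
      ((\<integral>\<^sup>+x. ennreal (\<pi> x * A x) \<partial>M) + (\<integral>\<^sup>+x. ennreal (\<pi> x * B x) \<partial>M))"
    by (simp add: nn_integral_cmult nn_integral_add)
  also have "\<dots> \<le> ennreal (1 / 2) * ((\<integral>\<^sup>+x. ennreal (\<pi> x) \<partial>M) + (\<integral>\<^sup>+x. ennreal (\<pi> x) \<partial>M))"
    using nn_integral_weight_ratio[OF Suc.prems, of 0] Suc.IH[of "2 * l"] Suc.prems
    by (intro mult_left_mono add_mono) (auto simp: A_def B_def)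
  also have "\<dots> = (\<integral>\<^sup>+x. ennreal (\<pi> x) \<partial>M)"
  proof -
    have "ennreal (1 / 2) * (a + a) = a" for a :: ennreal
    proof -
      have "ennreal (1 / 2) * (a + a) = (ennreal (1 / 2) + ennreal (1 / 2)) * a"
        by (simp only: distrib_left distrib_right)
      also have "ennreal (1 / 2) + ennreal (1 / 2) = 1"
        by (subst ennreal_plus[symmetric]) simp_all
      finally show ?thesis
        by simp
    qed
    then show ?thesis .
  qed
  finally show ?case .
qed

text \<open>
  As \<open>N\<close> tends to infinity, \<open>root (2 ^ N) (weight (2 ^ N * k) x)\<close> converges to \<open>rate x ^ k\<close>, so Fatou's
  lemma applies to the previous bound. Where the rate is infinite, the quotient is \<open>0\<close>.
\<close>

lemma nn_integral_weight_div_rate: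
  assumes k: "1 \<le> k"
  shows "(\<integral>\<^sup>+x. ennreal (\<pi> x) * (ennreal (weight k x) / rate x ^ k) \<partial>M) \<le> (\<integral>\<^sup>+x. ennreal (\<pi> x) \<partial>M)"
proof -
  define u where "u N x = ennreal (\<pi> x * (weight k x / root (2 ^ N) (weight (2 ^ N * k) x)))" for N x
  have u_meas: "u N \<in> borel_measurable M" for N
    unfolding u_def by measurable
  have "AE x in M. ennreal (\<pi> x) * (ennreal (weight k x) / rate x ^ k) = liminf (\<lambda>N. u N x)"
    using AE_rate \<pi>_pos
  proof eventually_elim
    case (elim x)
    define X where "X j = ennreal (root j (weight j x))" for j
    have X: "X \<longlonglongrightarrow> rate x"
      using elim(1) by (simp add: X_def[abs_def])
    have "strict_mono (\<lambda>N. 2 ^ N * k)"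
      using k by (auto simp: strict_mono_Suc_iff)
    then have "(\<lambda>N. X (2 ^ N * k)) \<longlonglongrightarrow> rate x"
      using LIMSEQ_subseq_LIMSEQ[OF X] by (simp add: o_def)
    then have "(\<lambda>N. X (2 ^ N * k) ^ k) \<longlonglongrightarrow> rate x ^ k"
      by (rule tendsto_power_ennreal) (use elim(1) in simp)
    then have "(\<lambda>N. inverse (X (2 ^ N * k) ^ k)) \<longlonglongrightarrow> inverse (rate x ^ k)"
      by (rule continuous_on_tendsto_compose[OF continuous_on_inverse_ennreal[OF continuous_on_id[of UNIV]]]) auto
    then have "(\<lambda>N. (ennreal (\<pi> x) * ennreal (weight k x)) * inverse (X (2 ^ N * k) ^ k)) \<longlonglongrightarrow>
        (ennreal (\<pi> x) * ennreal (weight k x)) * inverse (rate x ^ k)"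
      by (intro ennreal_tendsto_cmult) (simp_all add: ennreal_mult_less_top)
    moreover have "(ennreal (\<pi> x) * ennreal (weight k x)) * inverse (X (2 ^ N * k) ^ k) = u N x" for N
    proof -
      let ?W = "weight (2 ^ N * k) x"
      have pos: "0 < root (2 ^ N) ?W"
        using weight_pos by simp
      have "root (2 ^ N * k) ?W ^ k = root (2 ^ N) ?W"
      proof -
        have "root (2 ^ N * k) ?W = root k (root (2 ^ N) ?W)"
          by (subst mult.commute) (rule real_root_mult_exp)
        then show ?thesis
          using k pos by simp
      qed
      then have "X (2 ^ N * k) ^ k = ennreal (root (2 ^ N) ?W)"
        by (simp add: X_def ennreal_power real_root_ge_zero)
      then show ?thesis
        using elim(2) pos by (simp add: u_def inverse_ennreal ennreal_mult' divide_inverse mult_ac)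
    qed
    ultimately have "(\<lambda>N. u N x) \<longlonglongrightarrow> ennreal (\<pi> x) * (ennreal (weight k x) / rate x ^ k)"
      by (simp add: divide_ennreal_def mult_ac)
    then show ?case
      by (intro lim_imp_Liminf[symmetric]) auto
  qed
  then have "(\<integral>\<^sup>+x. ennreal (\<pi> x) * (ennreal (weight k x) / rate x ^ k) \<partial>M) = (\<integral>\<^sup>+x. liminf (\<lambda>N. u N x) \<partial>M)"
    by (rule nn_integral_cong_AE)
  also have "\<dots> \<le> liminf (\<lambda>N. \<integral>\<^sup>+x. u N x \<partial>M)"
    using u_meas by (rule nn_integral_liminf)
  also have "\<dots> \<le> liminf (\<lambda>N::nat. \<integral>\<^sup>+x. ennreal (\<pi> x) \<partial>M)"
    using nn_integral_weight_div_root[OF k] by (intro Liminf_mono always_eventually) (simp add: u_def)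
  also have "\<dots> = (\<integral>\<^sup>+x. ennreal (\<pi> x) \<partial>M)"
    by (simp add: Liminf_const)
  finally show ?thesis .
qed

section \<open>The essential supremum of the growth rate\<close>

lemma nn_integral_weight_le:
  assumes S: "AE x in M. rate x \<le> S" "S \<noteq> \<infinity>" and k: "1 \<le> k"
  shows "(\<integral>\<^sup>+x. ennreal (\<pi> x) * ennreal (weight k x) \<partial>M) \<le> S ^ k * (\<integral>\<^sup>+x. ennreal (\<pi> x) \<partial>M)"
proof -
  have "(\<integral>\<^sup>+x. ennreal (\<pi> x) * ennreal (weight k x) \<partial>M) \<le>
      (\<integral>\<^sup>+x. S ^ k * (ennreal (\<pi> x) * (ennreal (weight k x) / rate x ^ k)) \<partial>M)"
  proof (rule nn_integral_mono_AE)
    show "AE x in M. ennreal (\<pi> x) * ennreal (weight k x) \<le>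
        S ^ k * (ennreal (\<pi> x) * (ennreal (weight k x) / rate x ^ k))"
      using S(1) AE_rate
    proof eventually_elim
      case (elim x)
      have "rate x \<noteq> 0" "rate x \<noteq> \<infinity>"
        using elim S(2) by (auto simp: top_unique)
      then obtain g where g: "rate x = ennreal g" "0 < g"
        by (cases "rate x") auto
      have "ennreal (weight k x) = rate x ^ k * (ennreal (weight k x) / rate x ^ k)"
        using g(2) by (simp add: g(1) ennreal_power divide_ennreal flip: ennreal_mult)
      also have "\<dots> \<le> S ^ k * (ennreal (weight k x) / rate x ^ k)"
        using elim(1) by (intro mult_right_mono power_mono) auto
      finally have "ennreal (\<pi> x) * ennreal (weight k x) \<le>
          ennreal (\<pi> x) * (S ^ k * (ennreal (weight k x) / rate x ^ k))"
        by (intro mult_left_mono) auto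
      then show ?case
        by (simp add: mult_ac)
    qed
  qed
  also have "\<dots> = S ^ k * (\<integral>\<^sup>+x. ennreal (\<pi> x) * (ennreal (weight k x) / rate x ^ k) \<partial>M)"
    by (intro nn_integral_cmult) measurable
  also have "\<dots> \<le> S ^ k * (\<integral>\<^sup>+x. ennreal (\<pi> x) \<partial>M)"
    using nn_integral_weight_div_rate[OF k] by (intro mult_left_mono) auto
  finally show ?thesis .
qed

lemma \<pi>_integral_pos:
  assumes "A \<in> sets M" "emeasure M A \<noteq> 0"
  shows "0 < (\<integral>\<^sup>+x. ennreal (\<pi> x) * indicator A x \<partial>M)"
proof (rule ccontr)
  assume "\<not> ?thesis"
  then have "(\<integral>\<^sup>+x. ennreal (\<pi> x) * indicator A x \<partial>M) = 0"
    by simp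
  then have "AE x in M. ennreal (\<pi> x) * indicator A x = 0"
    using assms(1) by (subst (asm) nn_integral_0_iff_AE) auto
  then have "AE x in M. x \<notin> A"
    using \<pi>_pos by eventually_elim (auto simp: indicator_def split: if_splits)
  then show False
    using assms AE_iff_measurable[OF assms(1), of "\<lambda>x. x \<notin> A"] sets.sets_into_space[OF assms(1)] by auto
qed

lemma nn_integral_weight_ge:
  assumes c: "0 \<le> c" and A: "emeasure M {x \<in> space M. ennreal c < rate x} \<noteq> 0"
  shows "\<exists>\<eta>>0. \<forall>\<^sub>F k in sequentially.
    ennreal (c ^ k * \<eta>) \<le> (\<integral>\<^sup>+x. ennreal (\<pi> x) * ennreal (weight k x) \<partial>M)"
proof -
  let ?A = "{x \<in> space M. ennreal c < rate x}"
  define h where "h k x = ennreal (\<pi> x) * indicator {x \<in> space M. c ^ k \<le> weight k x} x" for k x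
  have h_meas [measurable]: "h k \<in> borel_measurable M" for k
    unfolding h_def by measurable
  have "(\<integral>\<^sup>+x. ennreal (\<pi> x) * indicator ?A x \<partial>M) \<le> (\<integral>\<^sup>+x. liminf (\<lambda>k. h k x) \<partial>M)"
  proof (rule nn_integral_mono_AE)
    show "AE x in M. ennreal (\<pi> x) * indicator ?A x \<le> liminf (\<lambda>k. h k x)"
      using AE_rate AE_space
    proof eventually_elim
      case (elim x)
      show ?case
      proof (cases "x \<in> ?A")
        case True
        then have "\<forall>\<^sub>F k in sequentially. ennreal c < ennreal (root k (weight k x))"
          using elim(1) order_tendstoD(1) by fastforce
        then have "\<forall>\<^sub>F k in sequentially. h k x = ennreal (\<pi> x)"
          using eventually_ge_at_top[of 1]
        proof eventually_elim
          case (elim k)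
          then have "c \<le> root k (weight k x)"
            using c by (simp add: ennreal_less_iff)
          then have "c ^ k \<le> root k (weight k x) ^ k"
            using c by (intro power_mono)
          also have "\<dots> = weight k x"
            using elim by simp
          finally show ?case
            using True by (simp add: h_def)
        qed
        then have "ennreal (\<pi> x) \<le> liminf (\<lambda>k. h k x)"
          by (intro Liminf_bounded) (auto elim: eventually_mono)
        then show ?thesis
          using True by simp
      qed simp
    qed
  qed
  also have "\<dots> \<le> liminf (\<lambda>k. \<integral>\<^sup>+x. h k x \<partial>M)"
    by (rule nn_integral_liminf) (rule h_meas)
  finally have liminf_ge: "(\<integral>\<^sup>+x. ennreal (\<pi> x) * indicator ?A x \<partial>M) \<le> liminf (\<lambda>k. \<integral>\<^sup>+x. h k x \<partial>M)" .
  have "?A \<in> sets M"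
    by measurable
  then have "0 < (\<integral>\<^sup>+x. ennreal (\<pi> x) * indicator ?A x \<partial>M)"
    using \<pi>_integral_pos A by blast
  then obtain e where e: "0 < e" "e < (\<integral>\<^sup>+x. ennreal (\<pi> x) * indicator ?A x \<partial>M)"
    using dense by blast
  have "e \<noteq> \<infinity>"
    using e(2) by auto
  then obtain \<eta> where \<eta>: "e = ennreal \<eta>" "0 < \<eta>"
    using e(1) by (cases e) auto
  have "ennreal \<eta> < liminf (\<lambda>k. \<integral>\<^sup>+x. h k x \<partial>M)"
    using e(2) liminf_ge \<eta>(1) by (simp add: less_le_trans)
  then have "\<forall>\<^sub>F k in sequentially. ennreal \<eta> < (\<integral>\<^sup>+x. h k x \<partial>M)"
    by (rule less_LiminfD)
  then have "\<forall>\<^sub>F k in sequentially.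
      ennreal (c ^ k * \<eta>) \<le> (\<integral>\<^sup>+x. ennreal (\<pi> x) * ennreal (weight k x) \<partial>M)"
  proof eventually_elim
    case (elim k)
    have "ennreal (c ^ k * \<eta>) = ennreal (c ^ k) * ennreal \<eta>"
      using c by (simp add: ennreal_mult')
    also have "\<dots> \<le> ennreal (c ^ k) * (\<integral>\<^sup>+x. h k x \<partial>M)"
      using elim by (intro mult_left_mono) auto
    also have "\<dots> = (\<integral>\<^sup>+x. ennreal (c ^ k) * h k x \<partial>M)"
      by (simp add: nn_integral_cmult)
    also have "\<dots> \<le> (\<integral>\<^sup>+x. ennreal (\<pi> x) * ennreal (weight k x) \<partial>M)"
      by (intro nn_integral_mono)
        (auto simp: h_def mult.commute indicator_def intro!: mult_left_mono ennreal_leI)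
    finally show ?case .
  qed
  then show ?thesis
    using \<eta>(2) by blast
qed

lemma ennroot_integral_tendsto:
  "(\<lambda>k. ennroot k (\<integral>\<^sup>+x. ennreal (\<pi> x) * ennreal (weight k x) \<partial>M)) \<longlonglongrightarrow> esssup M rate"
proof -
  define I where "I k = (\<integral>\<^sup>+x. ennreal (\<pi> x) * ennreal (weight k x) \<partial>M)" for k
  let ?S = "esssup M rate"
  have upper: "limsup (\<lambda>k. ennroot k (I k)) \<le> ?S"
  proof (cases ?S)
    case (real s)
    have "0 < (\<integral>\<^sup>+x. ennreal (\<pi> x) * indicator (space M) x \<partial>M)"
      using emeasure_space_1 by (intro \<pi>_integral_pos) auto
    also have "\<dots> = (\<integral>\<^sup>+x. ennreal (\<pi> x) \<partial>M)"
      by (intro nn_integral_cong) simp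
    finally have "0 < (\<integral>\<^sup>+x. ennreal (\<pi> x) \<partial>M)" .
    then obtain P where P: "(\<integral>\<^sup>+x. ennreal (\<pi> x) \<partial>M) = ennreal P" "0 < P"
      using \<pi>_integral_finite by (cases "\<integral>\<^sup>+x. ennreal (\<pi> x) \<partial>M") auto
    have "\<forall>\<^sub>F k in sequentially. ennroot k (I k) \<le> ennreal (s * root k P)"
      using eventually_ge_at_top[of 1]
    proof eventually_elim
      case (elim k)
      have "I k \<le> ?S ^ k * (\<integral>\<^sup>+x. ennreal (\<pi> x) \<partial>M)"
        unfolding I_def using real by (intro nn_integral_weight_le esssup_AE elim) simp
      also have "\<dots> = ennreal (s ^ k * P)"
        using real P by (simp add: ennreal_power ennreal_mult')
      finally have "ennroot k (I k) \<le> ennroot k (ennreal (s ^ k * P))"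
        by (rule ennroot_mono[OF elim])
      also have "\<dots> = ennreal (s * root k P)"
        using real P(2) elim by (simp add: ennroot_ennreal real_root_mult real_root_power_cancel)
      finally show ?case .
    qed
    then have "limsup (\<lambda>k. ennroot k (I k)) \<le> limsup (\<lambda>k. ennreal (s * root k P))"
      by (rule Limsup_mono)
    also have "\<dots> = ?S"
      using root_const_tendsto_ennreal[OF P(2), of s] real by (simp add: lim_imp_Limsup)
    finally show ?thesis .
  qed simp
  have lower: "?S \<le> liminf (\<lambda>k. ennroot k (I k))"
  proof (rule dense_le)
    fix a
    assume a: "a < ?S"
    then obtain c where c: "a = ennreal c" "0 \<le> c"
      by (cases a) auto
    have "emeasure M {x \<in> space M. ennreal c < rate x} \<noteq> 0"
      using esssup_pos_measure[OF rate_measurable a] c(1) by simp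
    then obtain \<eta> where \<eta>: "0 < \<eta>" "\<forall>\<^sub>F k in sequentially. ennreal (c ^ k * \<eta>) \<le> I k"
      using nn_integral_weight_ge[OF c(2)] unfolding I_def by blast
    have "a = liminf (\<lambda>k. ennreal (c * root k \<eta>))"
      using root_const_tendsto_ennreal[OF \<eta>(1), of c] c(1) by (simp add: lim_imp_Liminf)
    also have "\<dots> \<le> liminf (\<lambda>k. ennroot k (I k))"
    proof (rule Liminf_mono)
      show "\<forall>\<^sub>F k in sequentially. ennreal (c * root k \<eta>) \<le> ennroot k (I k)"
        using \<eta>(2) eventually_ge_at_top[of 1]
      proof eventually_elim
        case (elim k)
        have "ennreal (c * root k \<eta>) = ennroot k (ennreal (c ^ k * \<eta>))"
          using c(2) \<eta>(1) elim(2) by (simp add: ennroot_ennreal real_root_mult real_root_power_cancel)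
        also have "\<dots> \<le> ennroot k (I k)"
          using elim by (intro ennroot_mono)
        finally show ?case .
      qed
    qed
    finally show "a \<le> liminf (\<lambda>k. ennroot k (I k))" .
  qed
  have "liminf (\<lambda>k. ennroot k (I k)) \<le> limsup (\<lambda>k. ennroot k (I k))"
    by (rule Liminf_le_Limsup) simp
  then have "liminf (\<lambda>k. ennroot k (I k)) = ?S" "limsup (\<lambda>k. ennroot k (I k)) = ?S"
    using upper lower by (auto intro: antisym order_trans)
  then have "(\<lambda>k. ennroot k (I k)) \<longlonglongrightarrow> ?S"
    by (intro Liminf_eq_Limsup) auto
  then show ?thesis
    unfolding I_def .
qed

lemma Linf_norm_growth_rate: "Linf_norm M (growth_rate R f) = esssup M rate"
proof -
  have eq: "AE x in M. growth_rate R f x = rate x"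
    using AE_growth_rate by eventually_elim simp
  have "esssup (completion M) (growth_rate R f) = esssup (completion M) rate"
    using borel_measurable_completion_AE_eq[OF eq rate_measurable]
      measurable_completion[OF rate_measurable] AE_completion[OF eq]
    by (rule esssup_AE_cong)
  also have "\<dots> = esssup M rate"
    using measurable_completion[OF rate_measurable] rate_measurable
    by (simp add: esssup_eq_AE AE_completion_iff)
  finally show ?thesis
    by (simp add: Linf_norm_def)
qed

end

section \<open>The growth theorem\<close>

theorem theorem1p3:
  fixes M :: "'a measure" and R :: "('a \<times> 'a) set"
    and \<pi> :: "'a \<Rightarrow> real" and f :: "nat \<Rightarrow> 'a \<times> 'a \<Rightarrow> ennreal"
  assumes "standard_prob_space M"
    and "discrete_equiv_rel M R"
    and "measure_preserving_rel M R"
    and "integrable M \<pi>"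
    and "AE x in M. 0 < \<pi> x"
    and "\<And>k. 1 \<le> k \<Longrightarrow> f k \<in> borel_measurable (rel_measure M R)"
    and a: "\<And>k. 1 \<le> k \<Longrightarrow>
      AE (x, y) in rel_measure M R. ennreal (\<pi> x) * f k (x, y) = ennreal (\<pi> y) * f k (y, x)"
    and b: "\<And>l k. 1 \<le> l \<Longrightarrow> 1 \<le> k \<Longrightarrow>
      AE x in M. (\<Sum>\<^sub>\<infinity>(y, z)\<in>R `` {x} \<times> R `` {x}. f l (x, z) * f k (z, y))
        \<le> class_sum R (f (l + k)) x"
    and c: "AE x in M. \<forall>k\<ge>1. 0 < class_sum R (f k) x \<and> class_sum R (f k) x < \<infinity>"
    and d: "\<exists>D :: 'a \<Rightarrow> real. D \<in> borel_measurable M \<and> (\<forall>x\<in>space M. 0 < D x) \<and>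
      (AE x in M. \<forall>l\<ge>1. \<forall>k\<ge>1.
        class_sum R (f (l + k)) x \<ge> ennreal (D x) ^ l * class_sum R (f k) x)"
  shows "(AE x in M. convergent (\<lambda>k. ennroot k (class_sum R (f k) x)) \<and> 0 < growth_rate R f x)
    \<and> (\<forall>k\<ge>1. (\<integral>\<^sup>+x. ennreal (\<pi> x) * (class_sum R (f k) x / growth_rate R f x ^ k) \<partial>M)
          \<le> (\<integral>\<^sup>+x. ennreal (\<pi> x) \<partial>M))
    \<and> (\<lambda>k. ennroot k (\<integral>\<^sup>+x. ennreal (\<pi> x) * class_sum R (f k) x \<partial>M))
        \<longlonglongrightarrow> Linf_norm M (growth_rate R f)"
proof -
  interpret growth_family M R \<pi> f
    using assms by unfold_locales
  show ?thesis
  proof (intro conjI allI impI)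
    show "AE x in M. convergent (\<lambda>k. ennroot k (class_sum R (f k) x)) \<and> 0 < growth_rate R f x"
      using AE_growth_rate AE_rate by eventually_elim simp
    fix k :: nat
    assume k: "1 \<le> k"
    have "(\<integral>\<^sup>+x. ennreal (\<pi> x) * (class_sum R (f k) x / growth_rate R f x ^ k) \<partial>M) =
        (\<integral>\<^sup>+x. ennreal (\<pi> x) * (ennreal (weight k x) / rate x ^ k) \<partial>M)"
    proof (rule nn_integral_cong_AE)
      show "AE x in M. ennreal (\<pi> x) * (class_sum R (f k) x / growth_rate R f x ^ k) =
          ennreal (\<pi> x) * (ennreal (weight k x) / rate x ^ k)"
        using AE_growth_rate AE_class_sum_eq_weight by eventually_elim (use k in simp)
    qed
    then show "(\<integral>\<^sup>+x. ennreal (\<pi> x) * (class_sum R (f k) x / growth_rate R f x ^ k) \<partial>M)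
        \<le> (\<integral>\<^sup>+x. ennreal (\<pi> x) \<partial>M)"
      using nn_integral_weight_div_rate[OF k] by simp
  next
    have "\<forall>\<^sub>F k in sequentially.
        ennroot k (\<integral>\<^sup>+x. ennreal (\<pi> x) * ennreal (weight k x) \<partial>M) =
        ennroot k (\<integral>\<^sup>+x. ennreal (\<pi> x) * class_sum R (f k) x \<partial>M)"
      using eventually_ge_at_top[of 1]
    proof eventually_elim
      case (elim k)
      have "AE x in M. ennreal (\<pi> x) * ennreal (weight k x) = ennreal (\<pi> x) * class_sum R (f k) x"
        using AE_class_sum_eq_weight by eventually_elim (use elim in simp)
      then show ?case
        using nn_integral_cong_AE by fastforce
    qed
    then show "(\<lambda>k. ennroot k (\<integral>\<^sup>+x. ennreal (\<pi> x) * class_sum R (f k) x \<partial>M))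
        \<longlonglongrightarrow> Linf_norm M (growth_rate R f)"
      unfolding Linf_norm_growth_rate by (rule Lim_transform_eventually[OF ennroot_integral_tendsto])
  qed
qed

end
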